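(* Let $\alpha>0$ and $n>0$, let $\Sigma_0>0$ be fixed, and for $\nu>0$ set $c_\nu = 1+\nu\frac{n+1}{\alpha}$. For every $\nu>0$ there exists a solution $(\Sigma,U,\Theta)=(\Sigma_\nu,U_\nu,\Theta_\nu)$, defined for $\xi\in(0,\infty)$, of the system $$ \Sigma'=\xi U,\qquad \nu\Big(\tfrac{n+1}{\alpha}+\xi\Theta'\Big)=\Sigma U-1,\qquad \Sigma=e^{-\alpha\Theta}U^n , $$ subject to the initial condition $\Sigma(0)=\Sigma_0$, which satisfies the following properties. (i) It achieves the initial data $$ \lim_{\xi\to0}\big(\Sigma(\xi),U(\xi),\Theta(\xi)\big)=(\Sigma_0,U_0,\Theta_0), $$ where $U_0$ and $\Theta_0$ are defined by $U_0\Sigma_0=c_\nu$ and $\Theta_0=\frac{n+1}{\alpha}\log U_0-\frac1\alpha\log c_\nu$. (ii) As $\xi\to\infty$ it has the limiting behavior $$ U(\xi)=\frac1\xi+o\Big(\frac1\xi\Big),\qquad \Sigma(\xi)=\xi+o(\xi),\qquad \Theta(\xi)=-\frac{n+1}{\alpha}\log\xi+o(1). $$ (iii) The solution has the regularity $U,\Theta\in C^1[0,\infty)$ and $\Sigma\in C^2[0,\infty)$. It satisfies $$ \frac{d\Sigma}{d\xi}(0)=\frac{dU}{d\xi}(0)=\frac{d\Theta}{d\xi}(0)=0, $$ and as $\xi\to0$ it has the Taylor expansion $$ U(\xi)=U_0+o(\xi),\qquad \Sigma(\xi)=\Sigma_0+\tfrac12U_0\xi^2+o(\xi^2),\qquad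 \Theta(\xi)=\Theta_0+o(\xi). $$
   Context: The prime denotes $d/d\xi$. The unknowns are real-valued, with $U>0$ so that $U^n$ is meaningful for real $n>0$. The $o(\cdot)$ terms are for fixed $\nu$ (the rates may degenerate as $\nu\to0$). In (iii), the functions on $(0,\infty)$ are extended to $\xi=0$ by the limits in (i), and derivatives at $0$ are one-sided. The system is singular at $\xi=0$ because $\xi$ multiplies $\Theta'$. *)

theory Defs
  imports Complex_Main "HOL-Library.Landau_Symbols"
begin

text \<open>
  The profiles \<open>\<Sigma>\<close>, \<open>U\<close>, \<open>\<Theta>\<close> are written \<open>\<sigma>\<close>, \<open>u\<close>, \<open>\<theta>\<close>
  (\<open>\<Theta>\<close> is Landau notation in the library). The predicate requires \<open>u > 0\<close>, so that
  \<open>u powr n\<close> is the usual real power. It says nothing about \<open>\<xi> = 0\<close>, where the system is singular.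
\<close>

definition profile_solution ::
  "real \<Rightarrow> real \<Rightarrow> real \<Rightarrow> (real \<Rightarrow> real) \<Rightarrow> (real \<Rightarrow> real) \<Rightarrow> (real \<Rightarrow> real) \<Rightarrow> bool" where
  "profile_solution \<alpha> n \<nu> \<sigma> u \<theta> \<longleftrightarrow>
    (\<forall>\<xi>>0.
      u \<xi> > 0 \<and>
      (\<sigma> has_real_derivative \<xi> * u \<xi>) (at \<xi>) \<and>
      (\<exists>d\<theta>. (\<theta> has_real_derivative d\<theta>) (at \<xi>) \<and>
        \<nu> * ((n + 1) / \<alpha> + \<xi> * d\<theta>) = \<sigma> \<xi> * u \<xi> - 1) \<and>
      \<sigma> \<xi> = exp (- \<alpha> * \<theta> \<xi>) * u \<xi> powr n)"

text \<open>
  Derivatives are taken within \<open>S\<close>, hence one-sided at the endpoint of \<open>{0..}\<close>; the library's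
  \<open>C1_differentiable_on\<close> uses two-sided derivatives and does not fit there.
\<close>

primrec Ck_on :: "nat \<Rightarrow> (real \<Rightarrow> real) \<Rightarrow> real set \<Rightarrow> bool" where
  "Ck_on 0 f S \<longleftrightarrow> continuous_on S f"
| "Ck_on (Suc k) f S \<longleftrightarrow>
    (\<exists>f'. (\<forall>x\<in>S. (f has_real_derivative f' x) (at x within S)) \<and> Ck_on k f' S)"

end

theory Submission
  imports Defs "HOL-Analysis.Analysis"
begin

text \<open>
  Put \<open>\<kappa> = \<alpha> / \<nu>\<close>. In the scale-invariant variables \<open>p = \<sigma> u\<close> and \<open>q = \<xi>\<^sup>2 u / \<sigma>\<close> the system
  is autonomous in \<open>ln \<xi>\<close>, and the solution sought is the orbit joining the unstable node
  \<open>(p, q) = (c, 0)\<close> (\<open>\<xi> \<rightarrow> 0\<close>) to the saddle \<open>(1, 1)\<close> (\<open>\<xi> \<rightarrow> \<infinity>\<close>). With \<open>z = 1 - q\<close> and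
  \<open>\<rho> = \<kappa> (p - 1) / z + n - 1\<close>, taken as a function of \<open>t = ln (z / q)\<close>, the orbit solves a scalar
  equation \<open>\<rho>' = - H(\<rho>, z(t))\<close> for which an interval \<open>[a, 2n]\<close> is trapping. Substituting
  \<open>x = exp (M t)\<close> with \<open>M\<close> a Lipschitz constant of \<open>H\<close> turns this into \<open>(x R)' = \<Phi>(R, x)\<close> with \<open>\<Phi>\<close>
  monotone in \<open>R\<close>, which is solved on the whole half-line by monotone iteration of averages. The defect
  \<open>2n - \<rho>\<close> decays faster than \<open>exp (- t / 2)\<close>, that is, faster than \<open>\<xi>\<close>; this gives the vanishing
  derivatives at \<open>\<xi> = 0\<close>. Finally \<open>\<xi>\<close> is recovered from \<open>d(ln \<xi>)/dt = - n / \<rho>\<close>, and the free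
  additive constant there (the scaling symmetry) is used to match \<open>\<sigma>0\<close>.
\<close>

section \<open>Averages over \<open>{0..x}\<close> and a scalar equation singular at 0\<close>

text \<open>The integrand may oscillate at 0. Boundedness and measurability on the half-open
  interval suffice, and the added endpoint is negligible.\<close>

lemma bounded_continuous_integrable_from_0:
  fixes f :: "real \<Rightarrow> real"
  assumes cont: "continuous_on {0<..} f" and bound: "\<And>y. y > 0 \<Longrightarrow> \<bar>f y\<bar> \<le> B"
  shows "f integrable_on {0..x}"
proof -
  have "f integrable_on {0<..x}"
  proof (rule measurable_bounded_by_integrable_imp_integrable)
    show "f \<in> borel_measurable (lebesgue_on {0<..x})"
      by (rule continuous_imp_measurable_on_sets_lebesgue)
         (auto intro: continuous_on_subset[OF cont])
    show "(\<lambda>_. B) integrable_on {0<..x}"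
      by (rule integrable_spike_set[OF integrable_const_ivl[of B 0 x]])
         (auto intro: negligible_subset[of "{0}"])
  qed (auto simp: bound)
  then show ?thesis
    by (rule integrable_spike_set) (auto intro: negligible_subset[of "{0}"])
qed

lemma average_from_0_bounds:
  fixes f :: "real \<Rightarrow> real"
  assumes int: "f integrable_on {0..x}" and bound: "\<And>y. y > 0 \<Longrightarrow> f y \<in> {a..b}" and "x > 0"
  shows "integral {0..x} f / x \<in> {a..b}"
proof -
  \<comment> \<open>The bounds on \<open>f\<close> say nothing about \<open>f 0\<close>, so that
    value is replaced by \<open>a\<close>; the bound at 1 shows that \<open>{a..b}\<close> is
    nonempty.\<close>
  define g where "g y = (if y = 0 then a else f y)" for y
  have g: "g y \<in> {a..b}" if "y \<in> {0..x}" for y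
    using that bound[of 1] bound[of y] by (auto simp: g_def)
  have eq: "integral {0..x} f = integral {0..x} g"
    by (rule integral_spike[of "{0}"]) (auto simp: g_def)
  have gint: "g integrable_on {0..x}"
    by (rule integrable_spike[OF int, of "{0}"]) (auto simp: g_def)
  have "integral {0..x} (\<lambda>_. a) \<le> integral {0..x} g" "integral {0..x} g \<le> integral {0..x} (\<lambda>_. b)"
    using g by (intro integral_le gint integrable_const_ivl; auto)+
  then show ?thesis using \<open>x > 0\<close> by (simp add: eq field_simps)
qed

lemma average_from_0_continuous:
  fixes f :: "real \<Rightarrow> real"
  assumes int: "\<And>x. f integrable_on {0..x}"
  shows "continuous_on {0<..} (\<lambda>x. integral {0..x} f / x)"
proof (rule continuous_at_imp_continuous_on, rule ballI)
  fix x :: real assume "x \<in> {0<..}"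
  then have x: "x > 0" by simp
  have "continuous_on {0..x + 1} (\<lambda>x. integral {0..x} f)"
    by (rule indefinite_integral_continuous_1[OF int])
  then have "continuous (at x) (\<lambda>x. integral {0..x} f)"
    using x by (auto simp: continuous_on_interior)
  then show "isCont (\<lambda>x. integral {0..x} f / x) x"
    using x by (intro continuous_intros) auto
qed

lemma average_from_0_derivative:
  fixes f :: "real \<Rightarrow> real"
  assumes int: "\<And>x. f integrable_on {0..x}" and cont: "continuous_on {0<..} f" and "x > 0"
  shows "((\<lambda>x. integral {0..x} f / x) has_real_derivative (f x - integral {0..x} f / x) / x) (at x)"
proof -
  have "isCont f x"
    using cont \<open>x > 0\<close> by (simp add: continuous_on_eq_continuous_at)
  then have "((\<lambda>x. integral {0..x} f) has_vector_derivative f x) (at x within ({0..x+1} - {}))"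
    using \<open>x > 0\<close> by (intro integral_has_vector_derivative_continuous_at int)
      (auto intro: continuous_at_imp_continuous_at_within)
  moreover have "at x within {0..x+1} = at x"
    using \<open>x > 0\<close> by (intro at_within_interior) auto
  ultimately have *: "((\<lambda>x. integral {0..x} f) has_real_derivative f x) (at x)"
    by (simp add: has_real_derivative_iff_has_vector_derivative)
  show ?thesis
    using \<open>x > 0\<close> by (auto intro!: derivative_eq_intros * simp: field_simps)
qed

text \<open>Integrating \<open>(x R)' = \<Phi> R x\<close> from 0 gives the fixed-point equation
  \<open>R x = (1/x) \<integral> \<Phi> (R y) y dy\<close> over \<open>{0..x}\<close>. Its
  right-hand side is monotone in \<open>R\<close> and maps functions with values in
  \<open>{a..b}\<close> to such functions, so iterates started at the lower solution
  \<open>a\<close> increase to a fixed point. No initial value is prescribed: boundedness near 0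
  takes its place.\<close>

lemma singular_monotone_ode:
  fixes \<Phi> :: "real \<Rightarrow> real \<Rightarrow> real"
  assumes "a \<le> b"
    and cont: "continuous_on ({a..b} \<times> {0<..}) (\<lambda>(r, x). \<Phi> r x)"
    and mono: "\<And>r s x. a \<le> r \<Longrightarrow> r \<le> s \<Longrightarrow> s \<le> b \<Longrightarrow> x > 0 \<Longrightarrow> \<Phi> r x \<le> \<Phi> s x"
    and lower: "\<And>x. x > 0 \<Longrightarrow> a \<le> \<Phi> a x" and upper: "\<And>x. x > 0 \<Longrightarrow> \<Phi> b x \<le> b"
  obtains R where "\<And>x. x > 0 \<Longrightarrow> R x \<in> {a..b}"
    and "\<And>x. x > 0 \<Longrightarrow> (R has_real_derivative (\<Phi> (R x) x - R x) / x) (at x)"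
proof -
  \<comment> \<open>A constant value for \<open>x \<le> 0\<close> keeps the pointwise monotonicity on the closed interval \<open>{0..x}\<close>.\<close>
  define \<Psi> where "\<Psi> r x = (if x > 0 then \<Phi> r x else a)" for r x
  have \<Psi>: "\<Psi> r x = \<Phi> r x" if "x > 0" for r x using that by (simp add: \<Psi>_def)
  have cont: "continuous_on ({a..b} \<times> {0<..}) (\<lambda>(r, x). \<Psi> r x)"
    by (rule continuous_on_eq[OF cont]) (auto simp: \<Psi>)
  have mono: "\<Psi> r x \<le> \<Psi> s x" if "a \<le> r" "r \<le> s" "s \<le> b" for r s x
    using mono that by (simp add: \<Psi>_def)
  have lower: "a \<le> \<Psi> a x" and upper: "\<Psi> b x \<le> b" for x
    using lower upper \<open>a \<le> b\<close> by (simp_all add: \<Psi>_def)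
  define step :: "(real \<Rightarrow> real) \<Rightarrow> real \<Rightarrow> real"
    where "step f = (\<lambda>x. integral {0..x} (\<lambda>y. \<Psi> (f y) y) / x)" for f
  define I where "I k = (step ^^ k) (\<lambda>_. a)" for k
  have I_0: "I 0 = (\<lambda>_. a)" and I_Suc: "I (Suc k) = step (I k)" for k
    by (simp_all add: I_def)
  have \<Psi>_range: "\<Psi> r x \<in> {a..b}" if "r \<in> {a..b}" "x > 0" for r x
    using mono[of a r x] mono[of r b x] lower[of x] upper[of x] that by auto
  have \<Psi>_cont: "continuous_on {0<..} (\<lambda>y. \<Psi> (f y) y)"
    if "continuous_on {0<..} f" "\<And>y. y > 0 \<Longrightarrow> f y \<in> {a..b}" for f
  proof -
    have "continuous_on {0<..} ((\<lambda>(r, x). \<Psi> r x) \<circ> (\<lambda>y. (f y, y)))"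
      by (rule continuous_on_compose)
         (use that in \<open>auto intro!: continuous_intros continuous_on_subset[OF cont]\<close>)
    then show ?thesis by (simp add: o_def)
  qed
  have \<Psi>_int: "(\<lambda>y. \<Psi> (f y) y) integrable_on {0..x}"
    if "continuous_on {0<..} f" "\<And>y. y > 0 \<Longrightarrow> f y \<in> {a..b}" for f x
  proof (rule bounded_continuous_integrable_from_0[OF \<Psi>_cont[OF that]])
    fix y :: real assume "y > 0"
    then show "\<bar>\<Psi> (f y) y\<bar> \<le> \<bar>a\<bar> + \<bar>b\<bar>"
      using \<Psi>_range[of "f y" y] that(2)[of y] by simp linarith
  qed
  have I: "continuous_on {0<..} (I k) \<and> (\<forall>y>0. I k y \<in> {a..b})" for k
  proof (induction k)
    case 0
    then show ?case using \<open>a \<le> b\<close> by (simp add: I_0)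
  next
    case (Suc k)
    then have int: "(\<lambda>y. \<Psi> (I k y) y) integrable_on {0..x}" for x by (intro \<Psi>_int) auto
    show ?case unfolding I_Suc step_def using Suc
      by (intro conjI allI impI average_from_0_continuous average_from_0_bounds int)
        (auto intro!: \<Psi>_range simp del: atLeastAtMost_iff)
  qed
  have int_I: "(\<lambda>y. \<Psi> (I k y) y) integrable_on {0..x}" for k x using I by (intro \<Psi>_int) auto
  have \<Psi>_I_mono: "\<Psi> (I k y) y \<le> \<Psi> (I (Suc k) y) y" if "\<forall>y>0. I k y \<le> I (Suc k) y" for k y
  proof (cases "y > 0")
    case True
    then show ?thesis using that I by (intro mono) auto
  qed (simp add: \<Psi>_def)
  have I_mono: "\<forall>y>0. I k y \<le> I (Suc k) y" for k
  proof (induction k)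
    case 0
    then show ?case using I[of "Suc 0"] by (simp add: I_0)
  next
    case (Suc k)
    show ?case
    proof (intro allI impI)
      fix y :: real assume "y > 0"
      have "integral {0..y} (\<lambda>y. \<Psi> (I k y) y) \<le> integral {0..y} (\<lambda>y. \<Psi> (I (Suc k) y) y)"
        using Suc \<Psi>_I_mono by (intro integral_le int_I) auto
      then show "I (Suc k) y \<le> I (Suc (Suc k)) y"
        using \<open>y > 0\<close> by (simp add: I_Suc step_def divide_right_mono)
    qed
  qed
  define R where "R x = (if x > 0 then lim (\<lambda>k. I k x) else a)" for x
  have lim: "(\<lambda>k. I k x) \<longlonglongrightarrow> R x" if "x > 0" for x
  proof -
    have "incseq (\<lambda>k. I k x)" using I_mono that by (simp add: incseq_Suc_iff)
    moreover have "I k x \<le> b" for k using I that by simp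
    ultimately have "convergent (\<lambda>k. I k x)" by (metis incseq_convergent convergentI)
    then show ?thesis using that by (simp add: R_def convergent_LIMSEQ_iff)
  qed
  have R: "R x \<in> {a..b}" if "x > 0" for x
    using I that by (intro closed_sequentially[OF _ _ lim]) auto
  \<comment> \<open>At this stage \<open>R\<close> is only a pointwise limit; monotone convergence
    delivers the integrability of the limit integrand together with the limit of the
    integrals.\<close>
  have conv: "(\<lambda>y. \<Psi> (R y) y) integrable_on {0..x} \<and>
      (\<lambda>k. integral {0..x} (\<lambda>y. \<Psi> (I k y) y)) \<longlonglongrightarrow> integral {0..x} (\<lambda>y. \<Psi> (R y) y)" for x
  proof (rule monotone_convergence_increasing[OF int_I])
    fix k y assume "y \<in> {0..x}"
    then show "\<Psi> (I k y) y \<le> \<Psi> (I (Suc k) y) y" using \<Psi>_I_mono I_mono by simp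
  next
    fix y assume "y \<in> {0..x}"
    show "(\<lambda>k. \<Psi> (I k y) y) \<longlonglongrightarrow> \<Psi> (R y) y"
    proof (cases "y > 0")
      case True
      have "continuous_on {a..b} ((\<lambda>(r, x). \<Psi> r x) \<circ> (\<lambda>r. (r, y)))"
        by (rule continuous_on_compose)
           (use True in \<open>auto intro!: continuous_intros continuous_on_subset[OF cont]\<close>)
      then have "continuous_on {a..b} (\<lambda>r. \<Psi> r y)" by (simp add: o_def)
      then show ?thesis
        by (rule continuous_on_tendsto_compose[OF _ lim]) (use True I R[of y] in auto)
    qed (simp add: \<Psi>_def)
  next
    have "\<bar>integral {0..x} (\<lambda>y. \<Psi> (I k y) y)\<bar> \<le> \<bar>x\<bar> * (\<bar>a\<bar> + \<bar>b\<bar>)" for k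
    proof (cases "x > 0")
      case True
      then have "integral {0..x} (\<lambda>y. \<Psi> (I k y) y) / x \<in> {a..b}"
        using I[of "Suc k"] by (simp add: I_Suc step_def)
      then have "\<bar>integral {0..x} (\<lambda>y. \<Psi> (I k y) y) / x\<bar> \<le> \<bar>a\<bar> + \<bar>b\<bar>" by auto
      then show ?thesis using True by (simp add: abs_divide field_simps)
    next
      case False
      then have "{0..x} \<subseteq> {0}" by auto
      then have "integral {0..x} (\<lambda>y. \<Psi> (I k y) y) = 0"
        by (intro integral_unique has_integral_negligible[of "{0..x}"])
          (auto intro: negligible_subset[of "{0}"])
      then show ?thesis by simp
    qed
    then show "bounded (range (\<lambda>k. integral {0..x} (\<lambda>y. \<Psi> (I k y) y)))"
      by (auto simp: bounded_iff)
  qed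
  have R_eq: "R x = integral {0..x} (\<lambda>y. \<Psi> (R y) y) / x" if "x > 0" for x
  proof (rule LIMSEQ_unique)
    show "(\<lambda>k. I (Suc k) x) \<longlonglongrightarrow> R x" using lim[OF that] by (rule LIMSEQ_Suc)
    show "(\<lambda>k. I (Suc k) x) \<longlonglongrightarrow> integral {0..x} (\<lambda>y. \<Psi> (R y) y) / x"
      unfolding I_Suc step_def using conv that by (intro tendsto_intros) auto
  qed
  have int_R: "(\<lambda>y. \<Psi> (R y) y) integrable_on {0..x}" for x using conv by blast
  \<comment> \<open>Bootstrapping: as an average \<open>R\<close> is continuous, hence so is the
    integrand, hence the average is differentiable.\<close>
  have "continuous_on {0<..} R"
    using average_from_0_continuous[OF int_R] by (rule continuous_on_eq) (simp add: R_eq[symmetric])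
  then have cont_R: "continuous_on {0<..} (\<lambda>y. \<Psi> (R y) y)" using R by (intro \<Psi>_cont) auto
  have "(R has_real_derivative (\<Psi> (R x) x - R x) / x) (at x)" if "x > 0" for x
  proof (rule DERIV_cong_ev[THEN iffD1, OF refl _ _ average_from_0_derivative[OF int_R cont_R that]])
    show "\<forall>\<^sub>F x in nhds x. integral {0..x} (\<lambda>y. \<Psi> (R y) y) / x = R x"
      using eventually_nhds_in_open[of "{0<..}" x] that
      by (auto elim!: eventually_mono simp: R_eq[symmetric])
  qed (use R_eq[OF that] in simp)
  then have "(R has_real_derivative (\<Phi> (R x) x - R x) / x) (at x)" if "x > 0" for x
    using that by (simp add: \<Psi>)
  with R show ?thesis by (rule that)
qed

section \<open>Decay of the defect and the change of variable from \<open>t\<close> to \<xi>\<close>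

text \<open>The integrating factor \<open>exp (k * t)\<close> turns the forcing into a multiple of
  \<open>exp (- (1 - k) * t)\<close>, which is integrable at infinity because \<open>k < 1\<close>.
  Hence \<open>e t * exp (k * t)\<close> stays bounded above.\<close>

lemma exponential_decay:
  fixes e e' :: "real \<Rightarrow> real"
  assumes der: "\<And>t. (e has_real_derivative e' t) (at t)"
    and le: "\<And>t. t \<ge> t0 \<Longrightarrow> e' t \<le> - k * e t + C * exp (- t)"
    and k: "k < 1"
  shows "\<exists>B. \<forall>t\<ge>t0. e t \<le> B * exp (- k * t)"
proof -
  define K where "K = \<bar>C\<bar> / (1 - k)"
  have K: "K \<ge> 0" "K * (1 - k) = \<bar>C\<bar>" using k by (auto simp: K_def)
  \<comment> \<open>The second term has derivative
    \<open>- \<bar>C\<bar> * exp (- (1 - k) * t)\<close>, which compensates the forcing and makes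
    \<open>g\<close> nonincreasing.\<close>
  define g where "g t = e t * exp (k * t) + K * exp (- (1 - k) * t)" for t
  have dg: "(g has_real_derivative
      e' t * exp (k * t) + e t * (exp (k * t) * k) + K * (exp (- (1 - k) * t) * - (1 - k))) (at t)" for t
    unfolding g_def by (auto intro!: derivative_eq_intros der)
  have g_le: "g t \<le> g t0" if "t \<ge> t0" for t
  proof (rule DERIV_nonpos_imp_nonincreasing[OF that])
    fix s assume s: "t0 \<le> s" "s \<le> t"
    have "(e' s + k * e s) * exp (k * s) \<le> (\<bar>C\<bar> * exp (- s)) * exp (k * s)"
    proof (rule mult_right_mono)
      have "C * exp (- s) \<le> \<bar>C\<bar> * exp (- s)" by (intro mult_right_mono) auto
      then show "e' s + k * e s \<le> \<bar>C\<bar> * exp (- s)" using le[OF s(1)] by linarith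
    qed simp
    also have "\<dots> = \<bar>C\<bar> * exp (- (1 - k) * s)"
      by (simp add: algebra_simps flip: exp_add)
    also have "\<dots> = K * (exp (- (1 - k) * s) * (1 - k))"
      by (simp add: K(2)[symmetric])
    finally show "\<exists>y. (g has_real_derivative y) (at s) \<and> y \<le> 0"
      using dg[of s] by (auto simp: algebra_simps)
  qed
  have "e t \<le> g t0 * exp (- k * t)" if "t \<ge> t0" for t
  proof -
    have "e t * exp (k * t) \<le> g t"
      using K(1) by (simp add: g_def)
    then have "e t * exp (k * t) \<le> g t0" using g_le[OF that] by simp
    then have "e t * exp (k * t) * exp (- k * t) \<le> g t0 * exp (- k * t)"
      by (intro mult_right_mono) auto
    then show ?thesis by (simp add: mult.assoc flip: exp_add)
  qed
  then show ?thesis by blast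
qed

text \<open>Along the clock, \<open>- 2 * ln \<xi>\<close> equals \<open>t\<close> plus a correction
  whose derivative \<open>(2 * n - \<rho> t) / \<rho> t\<close> decays exponentially. The correction
  therefore converges as \<open>t\<close> tends to infinity, so \<open>\<xi>\<^sup>2 * exp t\<close>
  has a positive limit, and the additive constant of the clock adjusts that limit to
  \<open>l\<close>.\<close>

lemma inverse_clock:
  fixes \<rho> :: "real \<Rightarrow> real"
  assumes cont: "continuous_on UNIV \<rho>" and "n > 0" "a > 0" "b > 0" "l > 0"
    and lb: "\<And>t. a \<le> \<rho> t" and ub: "\<And>t. \<rho> t \<le> 2 * n"
    and decay: "\<forall>t\<ge>t0. 2 * n - \<rho> t \<le> B * exp (- b * t)"
  shows "\<exists>T. (\<forall>\<xi>>0. (T has_real_derivative - \<rho> (T \<xi>) / (n * \<xi>)) (at \<xi>)) \<and>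
    filterlim T at_top (at_right 0) \<and> filterlim T at_bot at_top \<and>
    ((\<lambda>\<xi>. \<xi>\<^sup>2 * exp (T \<xi>)) \<longlongrightarrow> l) (at_right 0)"
proof -
  \<comment> \<open>Chosen so that \<open>n / \<rho> t = (1 + f t) / 2\<close>.\<close>
  define f where "f t = (2 * n - \<rho> t) / \<rho> t" for t
  have \<rho>_pos: "\<rho> t > 0" for t using lb[of t] \<open>a > 0\<close> by simp
  have f_nonneg: "f t \<ge> 0" for t using ub[of t] \<rho>_pos[of t] by (simp add: f_def)
  have "isCont \<rho> t" for t using cont by (simp add: continuous_on_eq_continuous_at)
  then have "isCont f t" for t
    unfolding f_def using \<rho>_pos[of t] by (intro continuous_intros) auto
  then obtain F where "\<And>t. (F has_vector_derivative f t) (at t)"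
    using einterval_antiderivative[of "-\<infinity>" "\<infinity>" f] by auto
  then have F: "(F has_real_derivative f t) (at t)" for t
    by (simp add: has_real_derivative_iff_has_vector_derivative)
  have F_mono: "F s \<le> F t" if "s \<le> t" for s t
    using F f_nonneg by (intro DERIV_nonneg_imp_nondecreasing[OF that]) blast
  \<comment> \<open>\<open>K * exp (- b * t)\<close> bounds the integral of \<open>f\<close> from
    \<open>t\<close> to infinity when \<open>t \<ge> t0\<close>; this bounds \<open>F\<close> from
    above.\<close>
  define K where "K = \<bar>B\<bar> / (a * b)"
  have *: "F t + K * exp (- b * t) \<le> F t0 + K * exp (- b * t0)" if "t \<ge> t0" for t
  proof (rule DERIV_nonpos_imp_nonincreasing[OF that])
    fix s assume s: "t0 \<le> s" "s \<le> t"
    have "f s \<le> (B * exp (- b * s)) / \<rho> s"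
      unfolding f_def using decay s(1) \<rho>_pos[of s] by (intro divide_right_mono) auto
    also have "\<dots> \<le> (\<bar>B\<bar> * exp (- b * s)) / a"
      using lb[of s] \<open>a > 0\<close> \<rho>_pos[of s] by (intro frac_le mult_right_mono) auto
    also have "\<dots> = K * (exp (- b * s) * b)"
      using \<open>a > 0\<close> \<open>b > 0\<close> by (simp add: K_def)
    finally have "f s \<le> K * (exp (- b * s) * b)" .
    moreover have "((\<lambda>t. F t + K * exp (- b * t)) has_real_derivative
        f s + K * (exp (- b * s) * - b)) (at s)"
      by (auto intro!: derivative_eq_intros F)
    ultimately show "\<exists>y. ((\<lambda>t. F t + K * exp (- b * t)) has_real_derivative y) (at s) \<and> y \<le> 0"
      by (intro exI[of _ "f s + K * (exp (- b * s) * - b)"]) auto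
  qed
  have F_bound: "F t \<le> F t0 + K * exp (- b * t0)" for t
  proof -
    have "K \<ge> 0" using \<open>a > 0\<close> \<open>b > 0\<close> by (simp add: K_def)
    then have "K * exp (- b * s) \<ge> 0" for s by simp
    then show ?thesis
      using *[of t] F_mono[of t t0] by (smt (verit))
  qed
  obtain L where L: "(F \<longlongrightarrow> L) at_top"
  proof
    have bdd: "bdd_above (range F)" using F_bound by (intro bdd_aboveI2)
    show "(F \<longlongrightarrow> (SUP t. F t)) at_top"
    proof (rule order_tendstoI)
      fix y assume "y < (SUP t. F t)"
      then obtain s where "y < F s" using bdd by (auto simp: less_cSUP_iff)
      then show "\<forall>\<^sub>F t in at_top. y < F t"
        by (intro eventually_at_top_linorderI[of s]) (use F_mono in \<open>blast intro: less_le_trans\<close>)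
    next
      fix y assume "(SUP t. F t) < y"
      then show "\<forall>\<^sub>F t in at_top. F t < y"
        using bdd by (intro always_eventually allI) (meson cSUP_lessD UNIV_I)
    qed
  qed
  \<comment> \<open>With \<open>\<xi> = exp (- G t)\<close> one has
    \<open>\<xi>\<^sup>2 * exp t = exp (2 * d - F t)\<close>, and this \<open>d\<close> makes the
    limit equal to \<open>l\<close>.\<close>
  define d where "d = (ln l + L) / 2"
  \<comment> \<open>\<open>G\<close> is \<open>- ln \<xi>\<close> as a function of \<open>t\<close>.\<close>
  define G where "G t = (t + F t) / 2 - d" for t
  have G: "(G has_real_derivative n / \<rho> t) (at t)" for t
    unfolding G_def using \<rho>_pos[of t]
    by (auto intro!: derivative_eq_intros F simp: f_def field_simps)
  have G_less: "G s < G t" if "s < t" for s t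
    using F_mono[of s t] that by (simp add: G_def)
  have contG: "continuous_on S G" for S
    using G by (meson DERIV_isCont continuous_at_imp_continuous_on)
  have "\<exists>t. G t = y" for y
  proof -
    \<comment> \<open>Large enough that \<open>F (- c) \<le> F 0 \<le> F c\<close> already puts
      \<open>y\<close> between \<open>G (- c)\<close> and \<open>G c\<close>.\<close>
    define c where "c = 2 * \<bar>y + d\<bar> + \<bar>F 0\<bar>"
    have c: "c \<ge> 0" "2 * (y + d) - F 0 \<le> c" "F 0 - 2 * (y + d) \<le> c"
      unfolding c_def
      using abs_ge_self[of "y + d"] abs_ge_minus_self[of "y + d"] abs_ge_self[of "F 0"] abs_ge_minus_self[of "F 0"]
      by (simp_all add: algebra_simps)
    then have "F (- c) \<le> F 0" "F 0 \<le> F c" by (auto intro!: F_mono)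
    then have "G (- c) \<le> y" "y \<le> G c" using c by (simp_all add: G_def field_simps)
    then show ?thesis using IVT'[of G "- c" y c] contG c(1) by auto
  qed
  then obtain g where g: "\<And>y. G (g y) = y" by metis
  have G_inj: "G s = G t \<longleftrightarrow> s = t" for s t
    using G_less[of s t] G_less[of t s] by (cases s t rule: linorder_cases) auto
  have gG: "g (G t) = t" for t using g G_inj by blast
  have less_g: "t < g y \<longleftrightarrow> G t < y" and g_less: "g y < t \<longleftrightarrow> y < G t" for t y
    by (metis G_less g less_asym linorder_neqE)+
  have dg: "(g has_real_derivative \<rho> (g y) / n) (at y)" for y
  proof -
    have "isCont G t" for t using G DERIV_isCont by blast
    then have "isCont g y"
      using isCont_inverse_function[of 1 "g y" g G] gG g by simp
    then have "(g has_real_derivative inverse (n / \<rho> (g y))) (at y)"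
      using DERIV_inverse_function[OF G, of g y "y - 1" "y + 1"] \<rho>_pos[of "g y"] \<open>n > 0\<close> g
      by simp
    then show ?thesis by simp
  qed
  define T where "T \<xi> = g (- ln \<xi>)" for \<xi>
  show ?thesis
  proof (intro exI[of _ T] conjI allI impI)
    fix \<xi> :: real assume \<xi>: "\<xi> > 0"
    show "(T has_real_derivative - \<rho> (T \<xi>) / (n * \<xi>)) (at \<xi>)"
    proof -
      have "((\<lambda>\<xi>. - ln \<xi>) has_real_derivative - (1 / \<xi>)) (at \<xi>)"
        using \<xi> by (auto intro!: derivative_eq_intros)
      from DERIV_chain2[OF dg this] show ?thesis by (simp add: T_def[abs_def])
    qed
  next
    show top: "filterlim T at_top (at_right 0)"
      unfolding filterlim_at_top_dense
    proof
      fix t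
      show "\<forall>\<^sub>F \<xi> in at_right 0. t < T \<xi>"
        using eventually_at_right_real[OF exp_gt_zero[of "- G t"]]
      proof eventually_elim
        case (elim \<xi>)
        then have "ln \<xi> < - G t" by (metis exp_gt_zero greaterThanLessThan_iff ln_exp ln_less_cancel_iff)
        then show ?case by (simp add: T_def less_g)
      qed
    qed
    show "filterlim T at_bot at_top"
      unfolding filterlim_at_bot_dense
    proof
      fix t
      show "\<forall>\<^sub>F \<xi> in at_top. T \<xi> < t"
        using eventually_gt_at_top[of "exp (- G t)"]
      proof eventually_elim
        case (elim \<xi>)
        then have "- G t < ln \<xi>" by (metis exp_gt_zero ln_exp ln_less_cancel_iff order_less_trans)
        then show ?case by (simp add: T_def g_less)
      qed
    qed
    have "((\<lambda>t. exp (2 * d - F t)) \<longlongrightarrow> exp (2 * d - L)) at_top"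
      by (intro tendsto_intros L)
    then have "((\<lambda>\<xi>. exp (2 * d - F (T \<xi>))) \<longlongrightarrow> exp (2 * d - L)) (at_right 0)"
      using top by (rule filterlim_compose)
    moreover have "2 * d - L = ln l" by (simp add: d_def field_simps)
    then have "exp (2 * d - L) = l" using \<open>l > 0\<close> by simp
    moreover have "\<forall>\<^sub>F \<xi> in at_right 0. exp (2 * d - F (T \<xi>)) = \<xi>\<^sup>2 * exp (T \<xi>)"
      using eventually_at_right_less[of 0]
    proof eventually_elim
      case (elim \<xi>)
      have "G (T \<xi>) = - ln \<xi>" by (simp add: T_def g)
      then have "2 * d - F (T \<xi>) = 2 * ln \<xi> + T \<xi>" by (simp add: G_def field_simps)
      then show ?case using elim by (simp add: exp_add exp_double)
    qed
    ultimately show "((\<lambda>\<xi>. \<xi>\<^sup>2 * exp (T \<xi>)) \<longlongrightarrow> l) (at_right 0)"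
      using tendsto_cong by force
  qed
qed

section \<open>The variable \<open>z\<close> as a function of \<open>t\<close>\<close>

text \<open>This inverts \<open>t = ln (z / (1 - z))\<close>.\<close>

definition logistic :: "real \<Rightarrow> real" where
  "logistic t = exp t / (1 + exp t)"

lemma logistic_pos: "logistic t > 0"
  by (simp add: logistic_def add_pos_pos)

lemma one_minus_logistic: "1 - logistic t = 1 / (1 + exp t)"
proof -
  have "1 + exp t \<noteq> 0" using exp_gt_zero[of t] by linarith
  then show ?thesis by (simp add: logistic_def field_simps)
qed

lemma logistic_less_1: "logistic t < 1"
proof -
  have "1 - logistic t > 0" unfolding one_minus_logistic by (simp add: add_pos_pos)
  then show ?thesis by simp
qed

lemma one_minus_logistic_le: "1 - logistic t \<le> exp (- t)"
  unfolding one_minus_logistic exp_minus inverse_eq_divide by (intro frac_le) auto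

lemma logistic_derivative:
  "(logistic has_real_derivative logistic t * (1 - logistic t)) (at t)"
proof -
  have "1 + exp t \<noteq> 0" using exp_gt_zero[of t] by linarith
  then show ?thesis unfolding logistic_def[abs_def]
    by (auto intro!: derivative_eq_intros simp: field_simps power2_eq_square)
qed

lemma logistic_at_top: "(logistic \<longlongrightarrow> 1) at_top"
proof -
  have "((\<lambda>t. exp (- t)) \<longlongrightarrow> (0::real)) at_top"
    by (rule filterlim_compose[OF exp_at_bot filterlim_uminus_at_bot_at_top])
  then have "((\<lambda>t. 1 - logistic t) \<longlongrightarrow> 0) at_top"
    by (rule tendsto_sandwich[OF _ _ tendsto_const, rotated 2])
      (auto intro!: always_eventually simp: one_minus_logistic_le logistic_less_1 less_imp_le)
  then have "((\<lambda>t. 1 - (1 - logistic t)) \<longlongrightarrow> 1 - 0) at_top" by (intro tendsto_intros)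
  then show ?thesis by simp
qed

lemma logistic_at_bot: "(logistic \<longlongrightarrow> 0) at_bot"
proof -
  have "((\<lambda>t::real. exp t / (1 + exp t)) \<longlongrightarrow> 0 / (1 + 0)) at_bot"
    by (intro tendsto_intros exp_at_bot) auto
  then show ?thesis by (simp add: logistic_def[abs_def])
qed

section \<open>The connecting orbit\<close>

text \<open>The function \<open>H\<close> above: \<open>- orbit_slope n \<kappa> \<rho> z\<close> is \<open>d\<rho>/dt\<close>.\<close>

definition orbit_slope :: "real \<Rightarrow> real \<Rightarrow> real \<Rightarrow> real \<Rightarrow> real" where
  "orbit_slope n \<kappa> r z = r + \<kappa> - n + 1 - 2 * n * z - 2 * n * (\<kappa> - (n - 1) * z) / r"

text \<open>The quadratic equation says that \<open>a\<close> is the positive zero of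
  \<open>orbit_slope n \<kappa> r 0\<close> in \<open>r\<close>, the equilibrium at the end
  \<open>z = 0\<close>. The quadratic is negative at \<open>max 0 (n - 1)\<close> and positive at
  \<open>2 * n\<close>, so the intermediate value theorem places a root strictly between
  them.\<close>

lemma lower_barrier:
  fixes n \<kappa> :: real
  assumes "n > 0" "\<kappa> > 0"
  obtains a where "a > 0" "n - 1 < a" "a < 2 * n" "a\<^sup>2 + (\<kappa> - n + 1) * a = 2 * n * \<kappa>"
proof -
  define f where "f a = a\<^sup>2 + (\<kappa> - n + 1) * a - 2 * n * \<kappa>" for a
  define m where "m = max 0 (n - 1)"
  have "f (n - 1) = - \<kappa> * (n + 1)" by (simp add: f_def power2_eq_square algebra_simps)
  moreover have "f 0 = - 2 * (\<kappa> * n)" by (simp add: f_def)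
  moreover have "\<kappa> * (n + 1) > 0" "\<kappa> * n > 0" using assms by simp_all
  ultimately have m: "f m < 0" by (simp add: m_def max_def)
  have "f (2 * n) = 2 * n * (n + 1)" by (simp add: f_def power2_eq_square algebra_simps)
  then have top: "f (2 * n) > 0" using assms by simp
  have "continuous_on {m..2 * n} f" unfolding f_def by (intro continuous_intros)
  then obtain a where a: "m \<le> a" "a \<le> 2 * n" "f a = 0"
    using IVT'[of f m 0 "2 * n"] m top assms by (auto simp: m_def)
  then have "m \<noteq> a" "a \<noteq> 2 * n" using m top by auto
  then have "a > 0" "n - 1 < a" "a < 2 * n" using a by (auto simp: m_def)
  then show ?thesis using that a(3) by (simp add: f_def)
qed

text \<open>At \<open>a\<close> the slope of \<rho> is nonnegative and at \<open>2 * n\<close> it is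
  nonpositive, so the interval traps. The exponent must exceed 1/2 because \<open>exp (- t)\<close>
  will be comparable to the square of \<xi>: only then is the defect \<open>2 * n - \<rho>\<close>
  of smaller order than \<xi>.\<close>

lemma connecting_orbit:
  fixes n \<kappa> :: real
  assumes "n > 0" "\<kappa> > 0"
  shows "\<exists>a b \<rho> t0 B. a > 0 \<and> n - 1 < a \<and> b > 1 / 2 \<and> (\<forall>t. a \<le> \<rho> t) \<and> (\<forall>t. \<rho> t \<le> 2 * n) \<and>
    (\<forall>t. (\<rho> has_real_derivative - orbit_slope n \<kappa> (\<rho> t) (logistic t)) (at t)) \<and>
    (\<forall>t\<ge>t0. 2 * n - \<rho> t \<le> B * exp (- b * t))"
proof -
  obtain a where a: "a > 0" "n - 1 < a" "a < 2 * n" and root: "a\<^sup>2 + (\<kappa> - n + 1) * a = 2 * n * \<kappa>"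
    using lower_barrier[OF assms] .
  let ?H = "orbit_slope n \<kappa>"
  have root': "a + \<kappa> - n + 1 = 2 * n * \<kappa> / a"
    using root a(1) by (simp add: field_simps power2_eq_square)
  \<comment> \<open>The first term is a damping of \<open>2 * n - r\<close>, since the rate is positive for \<open>r \<ge> a\<close>; the second is \<open>O(exp (- t))\<close>.\<close>
  have H_split: "?H r z = - (2 * n - r) * (1 + (\<kappa> - n + 1) / r) + (1 - z) * (2 * n * (r - n + 1) / r)"
    if "r > 0" for r z
    using that by (simp add: orbit_slope_def field_simps)
  have H_a: "?H a z \<le> 0" if "0 \<le> z" for z
  proof -
    have "?H a z = - (2 * n * z * (a - n + 1) / a)"
      using a(1) root' by (simp add: orbit_slope_def field_simps)
    then show ?thesis using that a assms by simp
  qed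
  have H_2n: "?H (2 * n) z \<ge> 0" if "z \<le> 1" for z
    using H_split[of "2 * n" z] that assms by simp
  \<comment> \<open>An upper bound for the \<open>r\<close>-derivative
    \<open>1 + 2 * n * (\<kappa> - (n - 1) * z) / r\<^sup>2\<close> of \<open>orbit_slope\<close> on
    \<open>r \<ge> a\<close>, \<open>0 \<le> z \<le> 1\<close>, where
    \<open>- (n - 1) * z \<le> 1\<close>.\<close>
  define M where "M = 1 + 2 * n * (\<kappa> + 1) / a\<^sup>2"
  have M: "M > 0" using assms by (simp add: M_def add_pos_nonneg)
  have H_lipschitz: "?H s z - ?H r z \<le> M * (s - r)"
    if "a \<le> r" "r \<le> s" "0 \<le> z" "z \<le> 1" for r s z
  proof -
    have pos: "r > 0" "s > 0" using that a by auto
    have "- ((n - 1) * z) \<le> 1"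
    proof -
      have "- ((n - 1) * z) = z - n * z" by (simp add: algebra_simps)
      moreover have "0 \<le> n * z" using assms(1) that(3) by simp
      ultimately show ?thesis using that(4) by linarith
    qed
    then have "2 * n * (\<kappa> - (n - 1) * z) / (r * s) \<le> 2 * n * (\<kappa> + 1) / (r * s)"
      using pos assms by (intro divide_right_mono mult_left_mono) auto
    also have "\<dots> \<le> 2 * n * (\<kappa> + 1) / a\<^sup>2"
      unfolding power2_eq_square using that a assms by (intro divide_left_mono mult_mono) auto
    finally have "1 + 2 * n * (\<kappa> - (n - 1) * z) / (r * s) \<le> M" by (simp add: M_def)
    then have "(1 + 2 * n * (\<kappa> - (n - 1) * z) / (r * s)) * (s - r) \<le> M * (s - r)"
      using that by (intro mult_right_mono) auto
    moreover have "?H s z - ?H r z = (1 + 2 * n * (\<kappa> - (n - 1) * z) / (r * s)) * (s - r)"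
      using pos by (simp add: orbit_slope_def field_simps)
    ultimately show ?thesis by simp
  qed
  \<comment> \<open>With \<open>x = exp (M * t)\<close>, the equation
    \<open>x R' = \<Phi> R x - R\<close> becomes \<open>\<rho>' = - ?H\<close>. After division by
    \<open>M\<close> the term \<open>r\<close> dominates the growth of \<open>?H\<close>, which
    makes \<open>\<Phi>\<close> nondecreasing in \<open>r\<close>.\<close>
  define \<Phi> where "\<Phi> r x = r - ?H r (logistic (ln x / M)) / M" for r x
  have zr: "0 \<le> logistic t" "logistic t \<le> 1" for t
    using logistic_pos[of t] logistic_less_1[of t] by auto
  obtain R where R: "\<And>x. x > 0 \<Longrightarrow> R x \<in> {a..2 * n}"
    and dR: "\<And>x. x > 0 \<Longrightarrow> (R has_real_derivative (\<Phi> (R x) x - R x) / x) (at x)"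
  proof (rule singular_monotone_ode[of a "2 * n" \<Phi>])
    have "1 + exp t \<noteq> 0" for t :: real using exp_gt_zero[of t] by linarith
    then show "continuous_on ({a..2 * n} \<times> {0<..}) (\<lambda>(r, x). \<Phi> r x)"
      unfolding \<Phi>_def orbit_slope_def logistic_def case_prod_unfold using a M
      by (intro continuous_intros) auto
    show "\<Phi> r x \<le> \<Phi> s x" if "a \<le> r" "r \<le> s" for r s x
    proof -
      have "(?H s z - ?H r z) / M \<le> s - r" if "z = logistic (ln x / M)" for z
        using H_lipschitz[OF \<open>a \<le> r\<close> \<open>r \<le> s\<close> zr, of "ln x / M"] M that
        by (simp add: pos_divide_le_eq mult.commute)
      then show ?thesis by (simp add: \<Phi>_def diff_divide_distrib)
    qed
    show "a \<le> \<Phi> a x" "\<Phi> (2 * n) x \<le> 2 * n" for x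
      using H_a[OF zr(1)] H_2n[OF zr(2)] M by (simp_all add: \<Phi>_def divide_nonpos_pos)
  qed (use a in auto)
  define \<rho> where "\<rho> t = R (exp (M * t))" for t
  have \<rho>: "a \<le> \<rho> t" "\<rho> t \<le> 2 * n" for t using R[of "exp (M * t)"] by (simp_all add: \<rho>_def)
  have d\<rho>: "(\<rho> has_real_derivative - ?H (\<rho> t) (logistic t)) (at t)" for t
  proof -
    have "(\<rho> has_real_derivative
        (\<Phi> (\<rho> t) (exp (M * t)) - \<rho> t) / exp (M * t) * (exp (M * t) * M)) (at t)"
      unfolding \<rho>_def by (rule DERIV_chain2[OF dR]) (auto intro!: derivative_eq_intros)
    moreover have "(\<Phi> (\<rho> t) (exp (M * t)) - \<rho> t) / exp (M * t) * (exp (M * t) * M)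
        = - ?H (\<rho> t) (logistic t)"
      using M by (simp add: \<Phi>_def)
    ultimately show ?thesis by simp
  qed
  define e where "e t = 2 * n - \<rho> t" for t
  define rate where "rate r = 1 + (\<kappa> - n + 1) / r" for r
  \<comment> \<open>Bounds the factor \<open>2 * n * (r - n + 1) / r\<close> of \<open>1 - z\<close>
    in \<open>H_split\<close> for \<open>r \<ge> a\<close>.\<close>
  define C where "C = 2 * n * (1 + 1 / a)"
  have e: "e t \<ge> 0" for t using \<rho> by (simp add: e_def)
  have de: "(e has_real_derivative ?H (\<rho> t) (logistic t)) (at t)" for t
    unfolding e_def by (auto intro!: derivative_eq_intros d\<rho>)
  have H_le: "?H (\<rho> t) (logistic t) \<le> - k * e t + C * exp (- t)" if "k \<le> rate (\<rho> t)" for k t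
  proof -
    have pos: "\<rho> t > 0" using \<rho>[of t] a by simp
    have "(\<rho> t - n + 1) / \<rho> t \<le> 1 + 1 / \<rho> t" using pos assms by (simp add: field_simps)
    also have "\<dots> \<le> 1 + 1 / a" using \<rho>[of t] a by (simp add: frac_le)
    finally have "2 * n * ((\<rho> t - n + 1) / \<rho> t) \<le> C"
      unfolding C_def using assms by (intro mult_left_mono) auto
    moreover have "C \<ge> 0" using a assms by (simp add: C_def)
    ultimately have "(1 - logistic t) * (2 * n * ((\<rho> t - n + 1) / \<rho> t)) \<le> exp (- t) * C"
      using zr[of t] one_minus_logistic_le[of t] \<rho>[of t] a pos assms
      by (intro mult_mono) auto
    moreover have "k * e t \<le> rate (\<rho> t) * e t" using that e by (intro mult_right_mono)
    ultimately show ?thesis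
      using H_split[OF pos, of "logistic t"]
      unfolding e_def[symmetric] rate_def[symmetric] by (simp add: mult.commute)
  qed
  \<comment> \<open>A crude rate valid on all of \<open>{a..2 * n}\<close>: there
    \<open>r + \<kappa> - n + 1\<close> is at least its value \<open>2 * n * \<kappa> / a\<close> at
    \<open>r = a\<close>, hence at least \<open>\<kappa> / a * r\<close>. The cap 1/2 keeps the
    exponent below 1. This first pass only serves to show that \<rho> tends to
    \<open>2 * n\<close>.\<close>
  define k0 where "k0 = min (\<kappa> / a) (1 / 2)"
  have k0: "k0 > 0" "k0 < 1" using assms a by (auto simp: k0_def)
  have "k0 \<le> rate (\<rho> t)" for t
  proof -
    have pos: "\<rho> t > 0" using \<rho>[of t] a by simp
    have "\<kappa> / a * \<rho> t \<le> \<kappa> / a * (2 * n)" using \<rho>[of t] a assms by (intro mult_left_mono) auto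
    also have "\<dots> \<le> \<rho> t + \<kappa> - n + 1" 
    proof -
      have "\<kappa> / a * (2 * n) = 2 * n * \<kappa> / a" by simp
      then show ?thesis using root' \<rho>(1)[of t] by linarith
    qed
    finally have "\<kappa> / a \<le> rate (\<rho> t)" using pos by (simp add: rate_def field_simps)
    then show ?thesis by (simp add: k0_def)
  qed
  then have "\<exists>B. \<forall>t\<ge>0. e t \<le> B * exp (- k0 * t)"
    by (intro exponential_decay[where C = C, OF de H_le k0(2)])
  then obtain B0 where B0: "\<And>t. t \<ge> 0 \<Longrightarrow> e t \<le> B0 * exp (- k0 * t)" by blast
  have "((\<lambda>t. B0 * exp (- k0 * t)) \<longlongrightarrow> 0) at_top"
    using k0(1) by (intro tendsto_mult_right_zero filterlim_compose[OF exp_at_bot]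
        filterlim_tendsto_neg_mult_at_bot[OF tendsto_const] filterlim_ident) auto
  then have "(e \<longlongrightarrow> 0) at_top"
    by (rule tendsto_sandwich[OF _ _ tendsto_const, rotated 2])
      (use e B0 in \<open>auto intro!: always_eventually eventually_at_top_linorderI[of 0]\<close>)
  then have "((\<lambda>t. 2 * n - e t) \<longlongrightarrow> 2 * n - 0) at_top" by (intro tendsto_intros)
  then have "(\<rho> \<longlongrightarrow> 2 * n) at_top" by (simp add: e_def)
  then have lim: "((\<lambda>t. rate (\<rho> t)) \<longlongrightarrow> rate (2 * n)) at_top"
    unfolding rate_def using assms by (intro tendsto_intros) auto
  \<comment> \<open>The limiting rate exceeds \<open>1 / 2\<close>, so a second application of the decay estimate improves the exponent.\<close>
  define b where "b = min (3 / 4) (1 / 2 + (\<kappa> + 1) / (4 * n))"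
  have b: "b > 1 / 2" "b < 1" using assms by (simp_all add: b_def min_less_iff_disj)
  have "rate (2 * n) = 1 / 2 + (\<kappa> + 1) / (2 * n)" using assms by (simp add: rate_def field_simps)
  moreover have "(\<kappa> + 1) / (4 * n) < (\<kappa> + 1) / (2 * n)"
    using assms by (intro divide_strict_left_mono) auto
  ultimately have "b < rate (2 * n)" by (simp add: b_def)
  then have "\<forall>\<^sub>F t in at_top. b < rate (\<rho> t)" using lim by (rule order_tendstoD(1)[rotated])
  then obtain t0 where t0: "\<And>t. t \<ge> t0 \<Longrightarrow> b < rate (\<rho> t)"
    by (auto simp: eventually_at_top_linorder)
  have "\<exists>B. \<forall>t\<ge>t0. e t \<le> B * exp (- b * t)"
    by (intro exponential_decay[where C = C, OF de H_le b(2)] less_imp_le[OF t0])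
  then obtain B where B: "\<forall>t\<ge>t0. 2 * n - \<rho> t \<le> B * exp (- b * t)"
    unfolding e_def by blast
  show ?thesis using a b \<rho> d\<rho> B by blast
qed

section \<open>Continuously differentiable extension to the endpoint 0\<close>

lemma derivative_limit_0:
  fixes f f' :: "real \<Rightarrow> real"
  assumes der: "\<And>x. x > 0 \<Longrightarrow> (f has_real_derivative f' x) (at x)"
    and f0: "(f \<longlongrightarrow> f 0) (at_right 0)" and f'0: "(f' \<longlongrightarrow> D) (at_right 0)"
  shows "(f has_real_derivative D) (at 0 within {0..})"
proof -
  have "((\<lambda>x. (f x - f 0) / x) \<longlongrightarrow> D) (at_right 0)"
  proof (rule lhopital_right_0)
    show "((\<lambda>x. f x - f 0) \<longlongrightarrow> 0) (at_right 0)"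
      using tendsto_diff[OF f0 tendsto_const[of "f 0"]] by simp
    show "\<forall>\<^sub>F x in at_right 0. ((\<lambda>x. f x - f 0) has_real_derivative f' x) (at x)"
      using eventually_at_right_less[of 0]
      by eventually_elim (auto intro!: derivative_eq_intros der)
    show "\<forall>\<^sub>F x in at_right (0::real). ((\<lambda>x. x) has_real_derivative 1) (at x)"
      by (auto intro!: always_eventually derivative_intros)
    show "\<forall>\<^sub>F x in at_right (0::real). x \<noteq> 0"
      using eventually_at_right_less[of 0] by eventually_elim auto
  qed (use f'0 in auto)
  then show ?thesis
    by (simp add: has_field_derivative_iff at_within_Ici_at_right)
qed

text \<open>The profiles are first built on the open half-line. Extended by its limit, a function
  has at 0 the limit of its derivatives as one-sided derivative, by
  \<open>derivative_limit_0\<close>, so limits at 0 yield regularity up to the endpoint.\<close>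

lemma C1_extension_to_0:
  fixes f f' :: "real \<Rightarrow> real" and L D :: real
  defines "g \<equiv> \<lambda>x. if x > 0 then f x else L" and "g' \<equiv> \<lambda>x. if x > 0 then f' x else D"
  assumes der: "\<forall>x>0. (f has_real_derivative f' x) (at x)"
    and cont: "continuous_on {0<..} f'"
    and L: "(f \<longlongrightarrow> L) (at_right 0)" and D: "(f' \<longlongrightarrow> D) (at_right 0)"
  shows C1_extension_has_derivative: "\<And>x. x > 0 \<Longrightarrow> (g has_real_derivative f' x) (at x)"
    and C1_extension_has_derivative_within: "\<And>x. x \<ge> 0 \<Longrightarrow> (g has_real_derivative g' x) (at x within {0..})"
    and C1_extension_continuous_derivative: "continuous_on {0..} g'"
    and C1_extension_tendsto: "(g \<longlongrightarrow> L) (at_right 0)"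
proof -
  have ev: "\<forall>\<^sub>F x in at_right 0. f x = g x \<and> f' x = g' x"
    using eventually_at_right_less[of 0] by eventually_elim (simp add: g_def g'_def)
  show lim: "(g \<longlongrightarrow> L) (at_right 0)"
    using L by (rule tendsto_cong[THEN iffD1, rotated]) (use ev in \<open>auto elim: eventually_mono\<close>)
  have lim': "(g' \<longlongrightarrow> D) (at_right 0)"
    using D by (rule tendsto_cong[THEN iffD1, rotated]) (use ev in \<open>auto elim: eventually_mono\<close>)
  show dg: "(g has_real_derivative f' x) (at x)" if "x > 0" for x
  proof (rule has_field_derivative_transform_within_open[OF der[rule_format, OF that]])
    show "open {(0::real)<..}" by simp
  qed (use that in \<open>auto simp: g_def\<close>)
  show "(g has_real_derivative g' x) (at x within {0..})" if "x \<ge> 0" for x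
  proof (cases "x > 0")
    case True
    then show ?thesis using dg[OF True] by (simp add: g'_def has_field_derivative_at_within)
  next
    case False
    then have "x = 0" using that by simp
    moreover have "(g has_real_derivative D) (at 0 within {0..})"
      using derivative_limit_0[OF dg _ D] lim by (simp add: g_def)
    ultimately show ?thesis by (simp add: g'_def)
  qed
  show "continuous_on {0..} g'"
    unfolding continuous_on_def
  proof
    fix x :: real assume "x \<in> {0..}"
    show "(g' \<longlongrightarrow> g' x) (at x within {0..})"
    proof (cases "x > 0")
      case True
      have "continuous_on {0<..} g'" using cont by (rule continuous_on_eq) (simp add: g'_def)
      then have "isCont g' x" using True by (simp add: continuous_on_eq_continuous_at)
      then show ?thesis unfolding isCont_def by (rule tendsto_within_subset) simp
    next
      case False
      then have "x = 0" using \<open>x \<in> {0..}\<close> by simp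
      then show ?thesis using lim' by (simp add: g'_def at_within_Ici_at_right)
    qed
  qed
qed

lemma Ck_on_SucI:
  assumes "\<And>x. x \<in> S \<Longrightarrow> (f has_real_derivative f' x) (at x within S)" "Ck_on k f' S"
  shows "Ck_on (Suc k) f S"
  using assms by auto

section \<open>Profiles built from the connecting orbit\<close>

theorem theorem5p1:
  fixes \<alpha> n \<sigma>0 :: real
  assumes "\<alpha> > 0" and "n > 0" and "\<sigma>0 > 0"
  shows "\<forall>\<nu> c u0 \<theta>0 :: real.
    \<nu> > 0 \<longrightarrow>
    c = 1 + \<nu> * ((n + 1) / \<alpha>) \<longrightarrow>
    u0 * \<sigma>0 = c \<longrightarrow>
    \<theta>0 = (n + 1) / \<alpha> * ln u0 - 1 / \<alpha> * ln c \<longrightarrow>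
    (\<exists>\<sigma> u \<theta> :: real \<Rightarrow> real.
      profile_solution \<alpha> n \<nu> \<sigma> u \<theta> \<and>
      \<sigma> 0 = \<sigma>0 \<and> u 0 = u0 \<and> \<theta> 0 = \<theta>0 \<and>
      (\<sigma> \<longlongrightarrow> \<sigma>0) (at_right 0) \<and>
      (u \<longlongrightarrow> u0) (at_right 0) \<and>
      (\<theta> \<longlongrightarrow> \<theta>0) (at_right 0) \<and>
      (\<lambda>\<xi>. u \<xi> - 1 / \<xi>) \<in> o[at_top](\<lambda>\<xi>. 1 / \<xi>) \<and>
      (\<lambda>\<xi>. \<sigma> \<xi> - \<xi>) \<in> o[at_top](\<lambda>\<xi>. \<xi>) \<and>
      (\<lambda>\<xi>. \<theta> \<xi> - (- ((n + 1) / \<alpha>) * ln \<xi>)) \<in> o[at_top](\<lambda>\<xi>. 1) \<and>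
      Ck_on 1 u {0..} \<and> Ck_on 1 \<theta> {0..} \<and> Ck_on 2 \<sigma> {0..} \<and>
      (\<sigma> has_real_derivative 0) (at 0 within {0..}) \<and>
      (u has_real_derivative 0) (at 0 within {0..}) \<and>
      (\<theta> has_real_derivative 0) (at 0 within {0..}) \<and>
      (\<lambda>\<xi>. u \<xi> - u0) \<in> o[at_right 0](\<lambda>\<xi>. \<xi>) \<and>
      (\<lambda>\<xi>. \<sigma> \<xi> - (\<sigma>0 + 1 / 2 * u0 * \<xi>\<^sup>2)) \<in> o[at_right 0](\<lambda>\<xi>. \<xi>\<^sup>2) \<and>
      (\<lambda>\<xi>. \<theta> \<xi> - \<theta>0) \<in> o[at_right 0](\<lambda>\<xi>. \<xi>))"
proof (intro allI impI)
  fix \<nu> c u0 \<theta>0 :: real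
  assume "\<nu> > 0" and c: "c = 1 + \<nu> * ((n + 1) / \<alpha>)" and u0: "u0 * \<sigma>0 = c"
    and \<theta>0: "\<theta>0 = (n + 1) / \<alpha> * ln u0 - 1 / \<alpha> * ln c"
  define \<kappa> where "\<kappa> = \<alpha> / \<nu>"
  have \<kappa>: "\<kappa> > 0" using assms \<open>\<nu> > 0\<close> by (simp add: \<kappa>_def)
  have c': "c = 1 + (n + 1) / \<kappa>" by (simp add: c \<kappa>_def)
  have "c > 0" using \<kappa> assms by (simp add: c' add_pos_pos)
  have "u0 > 0" using u0 \<open>c > 0\<close> \<open>\<sigma>0 > 0\<close> by (metis zero_less_mult_pos2)
  \<comment> \<open>The third equation of the system solved for \<open>\<theta>0\<close>; it agrees
    with the prescribed value since \<open>ln c = ln u0 + ln \<sigma>0\<close>.\<close>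
  have \<theta>0': "\<theta>0 = (n * ln u0 - ln \<sigma>0) / \<alpha>"
    using \<open>u0 > 0\<close> \<open>\<sigma>0 > 0\<close> \<open>\<alpha> > 0\<close> by (simp add: \<theta>0 ln_mult field_simps flip: u0)
  obtain a b \<rho> t0 B where a: "a > 0" "n - 1 < a" and "b > 1 / 2"
    and \<rho>_bounds: "\<forall>t. a \<le> \<rho> t" "\<forall>t. \<rho> t \<le> 2 * n"
    and \<rho>_deriv: "\<forall>t. (\<rho> has_real_derivative - orbit_slope n \<kappa> (\<rho> t) (logistic t)) (at t)"
    and B: "\<forall>t\<ge>t0. 2 * n - \<rho> t \<le> B * exp (- b * t)"
    using connecting_orbit[OF \<open>n > 0\<close> \<kappa>] by (elim exE conjE) (rule that)
  note \<rho> = \<rho>_bounds[rule_format] and d\<rho> = \<rho>_deriv[rule_format]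
  \<comment> \<open>For the desired solution \<open>\<xi>\<^sup>2 * exp t = \<xi>\<^sup>2 * z / q =
    z * \<sigma> / u\<close>, which must tend to
    \<open>\<sigma>0 / u0 = \<sigma>0\<^sup>2 / c\<close>.\<close>
  define l where "l = \<sigma>0\<^sup>2 / c"
  have l: "l > 0" using \<open>c > 0\<close> \<open>\<sigma>0 > 0\<close> by (simp add: l_def)
  have cont_\<rho>: "continuous_on UNIV \<rho>"
    using d\<rho> by (meson DERIV_isCont continuous_at_imp_continuous_on)
  have "b > 0" using \<open>b > 1 / 2\<close> by simp
  obtain T where dT: "\<And>\<xi>. \<xi> > 0 \<Longrightarrow> (T has_real_derivative - \<rho> (T \<xi>) / (n * \<xi>)) (at \<xi>)"
    and T_0: "filterlim T at_top (at_right 0)" and T_inf: "filterlim T at_bot at_top"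
    and T_l: "((\<lambda>\<xi>. \<xi>\<^sup>2 * exp (T \<xi>)) \<longlongrightarrow> l) (at_right 0)"
    using inverse_clock[OF cont_\<rho> \<open>n > 0\<close> a(1) \<open>b > 0\<close> l \<rho> B] by blast
  have ev0: "\<forall>\<^sub>F \<xi> in at_right (0::real). \<xi> > 0" by (rule eventually_at_right_less)
  have ev_inf: "\<forall>\<^sub>F \<xi> in at_top. \<xi> > (0::real)" by (rule eventually_gt_at_top)

  \<comment> \<open>Return to the variable \<xi> and derivatives of the profiles\<close>
  define r where "r \<xi> = \<rho> (T \<xi>)" for \<xi>
  define z where "z \<xi> = logistic (T \<xi>)" for \<xi>
  define q where "q \<xi> = 1 - z \<xi>" for \<xi>
  \<comment> \<open>The relation \<open>\<rho> = \<kappa> * (p - 1) / z + n - 1\<close> solved for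
    \<open>p\<close>.\<close>
  define p where "p \<xi> = 1 + (r \<xi> - n + 1) * z \<xi> / \<kappa>" for \<xi>
  have r: "a \<le> r \<xi>" "r \<xi> \<le> 2 * n" "r \<xi> > 0" "r \<xi> - n + 1 > 0" for \<xi>
    using \<rho>(1)[of "T \<xi>"] \<rho>(2)[of "T \<xi>"] a by (simp_all add: r_def)
  have z: "z \<xi> > 0" and q: "q \<xi> > 0" for \<xi>
    using logistic_pos logistic_less_1 by (simp_all add: z_def q_def)
  have p: "p \<xi> > 0" for \<xi>
    using r z \<kappa> by (simp add: p_def add_pos_pos)
  have dz: "(z has_real_derivative - (z \<xi> * q \<xi> * r \<xi> / (n * \<xi>))) (at \<xi>)" if "\<xi> > 0" for \<xi>
    using DERIV_chain2[OF logistic_derivative dT[OF that]]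
    by (simp add: z_def[abs_def] q_def r_def)
  have dr: "(r has_real_derivative orbit_slope n \<kappa> (r \<xi>) (z \<xi>) * r \<xi> / (n * \<xi>)) (at \<xi>)"
    if "\<xi> > 0" for \<xi>
    using DERIV_chain2[OF d\<rho> dT[OF that]] by (simp add: z_def[abs_def] r_def[abs_def])
  have dq: "(q has_real_derivative q \<xi> * (z \<xi> * r \<xi> / (n * \<xi>))) (at \<xi>)" if "\<xi> > 0" for \<xi>
    unfolding q_def[abs_def]
    by (rule derivative_eq_intros dz that refl)+ (simp add: q_def)
  have dp: "(p has_real_derivative p \<xi> * (z \<xi> * (r \<xi> - 2 * n) / (n * \<xi>))) (at \<xi>)"
    if "\<xi> > 0" for \<xi>
  proof -
    have "((\<lambda>\<xi>. (r \<xi> - n + 1) * z \<xi>) has_real_derivative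
        orbit_slope n \<kappa> (r \<xi>) (z \<xi>) * r \<xi> / (n * \<xi>) * z \<xi>
        - (z \<xi> * q \<xi> * r \<xi> / (n * \<xi>)) * (r \<xi> - n + 1)) (at \<xi>)"
      by (rule derivative_eq_intros dz dr that refl)+ simp
    from DERIV_add[OF DERIV_const[of 1] DERIV_cdivide[OF this, of \<kappa>]]
    have "(p has_real_derivative (orbit_slope n \<kappa> (r \<xi>) (z \<xi>) * r \<xi> / (n * \<xi>) * z \<xi>
        - (z \<xi> * q \<xi> * r \<xi> / (n * \<xi>)) * (r \<xi> - n + 1)) / \<kappa>) (at \<xi>)"
      by (simp add: p_def[abs_def])
    \<comment> \<open>The formula for \<open>orbit_slope\<close> enters here: the first factor on
      the right is \<open>\<kappa> * p \<xi>\<close>, which gives \<open>p\<close> a simple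
      logarithmic derivative.\<close>
    moreover have "orbit_slope n \<kappa> (r \<xi>) (z \<xi>) * r \<xi> - q \<xi> * r \<xi> * (r \<xi> - n + 1)
        = (\<kappa> + (r \<xi> - n + 1) * z \<xi>) * (r \<xi> - 2 * n)"
      using r(3)[of \<xi>] by (simp add: orbit_slope_def q_def field_simps)
    then have "(orbit_slope n \<kappa> (r \<xi>) (z \<xi>) * r \<xi> / (n * \<xi>) * z \<xi>
        - (z \<xi> * q \<xi> * r \<xi> / (n * \<xi>)) * (r \<xi> - n + 1)) / \<kappa>
        = p \<xi> * (z \<xi> * (r \<xi> - 2 * n) / (n * \<xi>))"
      using \<kappa> that \<open>n > 0\<close> by (simp add: p_def field_simps) algebra
    ultimately show ?thesis by simp
  qed

  define P where "P \<xi> = ln (p \<xi>)" for \<xi>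
  define Q where "Q \<xi> = ln (q \<xi>)" for \<xi>
  \<comment> \<open>Solving \<open>p = \<sigma> * u\<close> and
    \<open>q = \<xi>\<^sup>2 * u / \<sigma>\<close> gives
    \<open>\<sigma> = \<xi> * sqrt (p / q)\<close> and \<open>u = sqrt (p * q) / \<xi>\<close>; the
    exponential form makes positivity and logarithmic derivatives immediate.\<close>
  define S where "S \<xi> = exp (ln \<xi> + (P \<xi> - Q \<xi>) / 2)" for \<xi>
  define V where "V \<xi> = exp ((P \<xi> + Q \<xi>) / 2 - ln \<xi>)" for \<xi>
  define \<Theta> where "\<Theta> \<xi> = (n * ln (V \<xi>) - ln (S \<xi>)) / \<alpha>" for \<xi>
  have SV: "S \<xi> * V \<xi> = p \<xi>" for \<xi>
    using p[of \<xi>] by (simp add: S_def V_def P_def field_simps flip: exp_add)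
  have Sq: "S \<xi> * q \<xi> = \<xi>\<^sup>2 * V \<xi>" if "\<xi> > 0" for \<xi>
  proof -
    have "S \<xi> * exp (Q \<xi>) = exp (2 * ln \<xi>) * V \<xi>"
      by (simp add: S_def V_def field_simps flip: exp_add)
    then show ?thesis using that q[of \<xi>] by (simp add: exp_double Q_def)
  qed
  \<comment> \<open>Both derivatives are grouped around \<open>(2 * n - r \<xi>) / \<xi>\<close> and
    \<open>q \<xi> / \<xi>\<close>, the two quantities that vanish at 0.\<close>
  define V' where "V' \<xi> = V \<xi> * - ((2 * n - r \<xi>) / \<xi> * z \<xi> / n + q \<xi> / \<xi>)" for \<xi>
  define \<Theta>' where "\<Theta>' \<xi> = - (((2 * n - r \<xi>) / \<xi> * z \<xi> + (n + 1) * (q \<xi> / \<xi>)) / \<alpha>)" for \<xi>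
  have log_deriv: "((\<lambda>\<xi>. ln (f \<xi>)) has_real_derivative d) (at \<xi>)"
    if "(f has_real_derivative f \<xi> * d) (at \<xi>)" "f \<xi> > 0" for f :: "real \<Rightarrow> real" and d \<xi>
    using DERIV_chain2[OF DERIV_ln[OF that(2)] that(1)] that(2) by (simp add: mult.assoc[symmetric])
  note dP = log_deriv[OF dp p, folded P_def] and dQ = log_deriv[OF dq q, folded Q_def]
  have dS: "(S has_real_derivative \<xi> * V \<xi>) (at \<xi>)" if "\<xi> > 0" for \<xi>
  proof -
    have "(S has_real_derivative S \<xi> * (1 / \<xi> +
        (z \<xi> * (r \<xi> - 2 * n) / (n * \<xi>) - z \<xi> * r \<xi> / (n * \<xi>)) / 2)) (at \<xi>)"
      unfolding S_def[abs_def] using that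
      by (auto intro!: derivative_eq_intros dP dQ simp: mult.commute mult.left_commute)
    moreover have "1 / \<xi> + (z \<xi> * (r \<xi> - 2 * n) / (n * \<xi>) - z \<xi> * r \<xi> / (n * \<xi>)) / 2 = q \<xi> / \<xi>"
      using that \<open>n > 0\<close> by (simp add: q_def field_simps)
    ultimately show ?thesis using Sq[OF that] that by (simp add: power2_eq_square)
  qed
  have dlnV: "((\<lambda>\<xi>. (P \<xi> + Q \<xi>) / 2 - ln \<xi>) has_real_derivative
      - ((2 * n - r \<xi>) / \<xi> * z \<xi> / n + q \<xi> / \<xi>)) (at \<xi>)" if "\<xi> > 0" for \<xi>
    using that \<open>n > 0\<close>
    by (auto intro!: derivative_eq_intros dP dQ simp: q_def field_simps)
  have dV: "(V has_real_derivative V' \<xi>) (at \<xi>)" if "\<xi> > 0" for \<xi>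
    using DERIV_chain2[OF DERIV_exp dlnV[OF that]] by (simp only: V_def[abs_def] V'_def)
  have d\<Theta>: "(\<Theta> has_real_derivative \<Theta>' \<xi>) (at \<xi>)" if "\<xi> > 0" for \<xi>
  proof -
    have dlnS: "((\<lambda>\<xi>. ln (S \<xi>)) has_real_derivative q \<xi> / \<xi>) (at \<xi>)"
      unfolding S_def ln_exp using that \<open>n > 0\<close>
      by (auto intro!: derivative_eq_intros dP dQ simp: q_def field_simps)
    have "((\<lambda>\<xi>. ln (V \<xi>)) has_real_derivative
        - ((2 * n - r \<xi>) / \<xi> * z \<xi> / n + q \<xi> / \<xi>)) (at \<xi>)"
      unfolding V_def ln_exp by (rule dlnV[OF that])
    from DERIV_cdivide[OF DERIV_diff[OF DERIV_cmult[OF this, of n] dlnS], of \<alpha>]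
    have "(\<Theta> has_real_derivative
        (n * - ((2 * n - r \<xi>) / \<xi> * z \<xi> / n + q \<xi> / \<xi>) - q \<xi> / \<xi>) / \<alpha>) (at \<xi>)"
      by (simp only: \<Theta>_def[abs_def])
    moreover have "(n * - ((2 * n - r \<xi>) / \<xi> * z \<xi> / n + q \<xi> / \<xi>) - q \<xi> / \<xi>) / \<alpha> = \<Theta>' \<xi>"
      using \<open>\<alpha> > 0\<close> \<open>n > 0\<close> that by (simp add: \<Theta>'_def field_simps)
    ultimately show ?thesis by simp
  qed
  have cont_fun: "continuous_on {0<..} f" if "\<And>\<xi>. \<xi> > 0 \<Longrightarrow> (f has_real_derivative f' \<xi>) (at \<xi>)"
    for f f' :: "real \<Rightarrow> real"
    using that by (meson DERIV_isCont continuous_at_imp_continuous_on greaterThan_iff)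
  have cont_V': "continuous_on {0<..} V'" and cont_\<Theta>': "continuous_on {0<..} \<Theta>'"
    unfolding V'_def[abs_def] \<Theta>'_def[abs_def] using \<open>\<alpha> > 0\<close> \<open>n > 0\<close>
    by (intro continuous_intros cont_fun[OF dV] cont_fun[OF dr] cont_fun[OF dz] cont_fun[OF dq]; simp)+

  \<comment> \<open>Limits as \<xi> tends to 0\<close>
  have q_0: "((\<lambda>\<xi>. q \<xi> / \<xi>) \<longlongrightarrow> 0) (at_right 0)"
  proof (rule tendsto_sandwich[OF _ _ tendsto_const])
    \<comment> \<open>\<open>q\<close> is at most \<open>exp (- T \<xi>)\<close>, which is of order
      \<open>\<xi>\<^sup>2\<close> because \<open>\<xi>\<^sup>2 * exp (T \<xi>)\<close> has a
      positive limit.\<close>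
    show "\<forall>\<^sub>F \<xi> in at_right 0. q \<xi> / \<xi> \<le> \<xi> / (\<xi>\<^sup>2 * exp (T \<xi>))"
      using ev0
    proof eventually_elim
      case (elim \<xi>)
      have "q \<xi> / \<xi> \<le> exp (- T \<xi>) / \<xi>"
        using elim one_minus_logistic_le[of "T \<xi>"]
        by (intro divide_right_mono) (auto simp: q_def z_def)
      also have "\<dots> = \<xi> / (\<xi>\<^sup>2 * exp (T \<xi>))"
        using elim by (simp add: exp_minus field_simps power2_eq_square)
      finally show ?case .
    qed
    show "((\<lambda>\<xi>. \<xi> / (\<xi>\<^sup>2 * exp (T \<xi>))) \<longlongrightarrow> 0) (at_right 0)"
      using tendsto_divide[OF tendsto_ident_at T_l] l by simp
    show "\<forall>\<^sub>F \<xi> in at_right 0. 0 \<le> q \<xi> / \<xi>"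
      using ev0 by eventually_elim (use q in \<open>simp add: less_imp_le\<close>)
  qed
  have r_0: "((\<lambda>\<xi>. (2 * n - r \<xi>) / \<xi>) \<longlongrightarrow> 0) (at_right 0)"
  proof (rule tendsto_sandwich[OF _ _ tendsto_const])
    \<comment> \<open>The bound \<open>B * exp (- b * T \<xi>) / \<xi>\<close>, rewritten as a
      convergent factor times \<open>\<xi> powr (2 * b - 1)\<close>; the exponent is positive
      precisely because \<open>b > 1 / 2\<close>.\<close>
    let ?h = "\<lambda>\<xi>. B * ((\<xi>\<^sup>2 * exp (T \<xi>)) powr (- b) * \<xi> powr (2 * b - 1))"
    have "\<forall>\<^sub>F \<xi> in at_right 0. T \<xi> \<ge> t0"
      using T_0 by (simp add: filterlim_at_top)
    with ev0 show "\<forall>\<^sub>F \<xi> in at_right 0. (2 * n - r \<xi>) / \<xi> \<le> ?h \<xi>"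
    proof eventually_elim
      case (elim \<xi>)
      have "(2 * n - r \<xi>) / \<xi> \<le> B * exp (- b * T \<xi>) / \<xi>"
        using elim B by (intro divide_right_mono) (auto simp: r_def)
      also have "\<dots> = B * (exp (- b * T \<xi>) / \<xi>)" by simp
      also have "exp (- b * T \<xi>) / \<xi> = (\<xi>\<^sup>2 * exp (T \<xi>)) powr (- b) * \<xi> powr (2 * b - 1)"
      proof -
        have "ln (\<xi>\<^sup>2 * exp (T \<xi>)) = 2 * ln \<xi> + T \<xi>"
          using elim by (simp add: ln_mult ln_realpow)
        then have "(\<xi>\<^sup>2 * exp (T \<xi>)) powr (- b) * \<xi> powr (2 * b - 1) = exp (- b * T \<xi> - ln \<xi>)"
          using elim by (simp add: powr_def algebra_simps flip: exp_add)
        then show ?thesis using elim by (simp add: exp_diff)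
      qed
      finally show ?case .
    qed
    have "((\<lambda>\<xi>. (\<xi>\<^sup>2 * exp (T \<xi>)) powr (- b)) \<longlongrightarrow> l powr (- b)) (at_right 0)"
      using T_l l by (intro tendsto_intros) auto
    moreover have "((\<lambda>\<xi>. \<xi> powr (2 * b - 1)) \<longlongrightarrow> 0) (at_right (0::real))"
      using \<open>b > 1 / 2\<close> ev0
      by (intro tendsto_zero_powrI[OF tendsto_ident_at tendsto_const])
        (auto elim!: eventually_mono)
    ultimately have "(?h \<longlongrightarrow> B * (l powr (- b) * 0)) (at_right 0)"
      by (intro tendsto_mult tendsto_const)
    then show "(?h \<longlongrightarrow> 0) (at_right 0)" by simp
    show "\<forall>\<^sub>F \<xi> in at_right 0. 0 \<le> (2 * n - r \<xi>) / \<xi>"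
      using ev0 by eventually_elim (use r in simp)
  qed
  have z_lim: "(z \<longlongrightarrow> 1) (at_right 0)"
    unfolding z_def[abs_def] by (rule filterlim_compose[OF logistic_at_top T_0])
  have r_lim: "(r \<longlongrightarrow> 2 * n) (at_right 0)"
  proof -
    have "((\<lambda>\<xi>. 2 * n - (2 * n - r \<xi>) / \<xi> * \<xi>) \<longlongrightarrow> 2 * n - 0 * 0) (at_right 0)"
      by (intro tendsto_intros r_0)
    moreover have "\<forall>\<^sub>F \<xi> in at_right 0. 2 * n - (2 * n - r \<xi>) / \<xi> * \<xi> = r \<xi>"
      using ev0 by eventually_elim simp
    ultimately show ?thesis by (simp add: tendsto_cong)
  qed
  have p_lim: "(p \<longlongrightarrow> c) (at_right 0)"
  proof -
    have "(p \<longlongrightarrow> 1 + (2 * n - n + 1) * 1 / \<kappa>) (at_right 0)"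
      unfolding p_def[abs_def] using \<kappa> by (intro tendsto_intros r_lim z_lim) auto
    then show ?thesis by (simp add: c')
  qed
  have S_lim: "(S \<longlongrightarrow> \<sigma>0) (at_right 0)"
  proof -
    \<comment> \<open>The square of \<open>S\<close> is \<open>\<xi>\<^sup>2 * p / q\<close> with
      \<open>1 / q = 1 + exp T\<close>; the choice of \<open>l\<close> makes the limit
      \<open>\<sigma>0\<close>.\<close>
    have "((\<lambda>\<xi>. sqrt ((\<xi>\<^sup>2 + \<xi>\<^sup>2 * exp (T \<xi>)) * p \<xi>)) \<longlongrightarrow> sqrt ((0\<^sup>2 + l) * c)) (at_right 0)"
      by (intro tendsto_intros T_l p_lim)
    moreover have "sqrt ((0\<^sup>2 + l) * c) = \<sigma>0"
      using \<open>c > 0\<close> \<open>\<sigma>0 > 0\<close> by (simp add: l_def)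
    moreover have "\<forall>\<^sub>F \<xi> in at_right 0. sqrt ((\<xi>\<^sup>2 + \<xi>\<^sup>2 * exp (T \<xi>)) * p \<xi>) = S \<xi>"
      using ev0
    proof eventually_elim
      case (elim \<xi>)
      have "(S \<xi>)\<^sup>2 * q \<xi> = \<xi>\<^sup>2 * p \<xi>"
        using Sq[OF elim] SV[of \<xi>] by (simp add: power2_eq_square algebra_simps)
      moreover have "q \<xi> = 1 / (1 + exp (T \<xi>))" by (simp add: q_def z_def one_minus_logistic)
      moreover have "1 + exp (T \<xi>) > 0" by (simp add: add_pos_pos)
      ultimately have "(\<xi>\<^sup>2 + \<xi>\<^sup>2 * exp (T \<xi>)) * p \<xi> = (S \<xi>)\<^sup>2" by (simp add: field_simps)
      moreover have "S \<xi> > 0" by (simp add: S_def)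
      ultimately show ?case by simp
    qed
    ultimately show ?thesis by (simp add: tendsto_cong)
  qed
  have V_lim: "(V \<longlongrightarrow> u0) (at_right 0)"
  proof -
    have "((\<lambda>\<xi>. p \<xi> / S \<xi>) \<longlongrightarrow> c / \<sigma>0) (at_right 0)"
      using \<open>\<sigma>0 > 0\<close> by (intro tendsto_intros p_lim S_lim) auto
    moreover have "p \<xi> / S \<xi> = V \<xi>" for \<xi> using SV[of \<xi>] by (auto simp: S_def field_simps)
    ultimately show ?thesis using \<open>\<sigma>0 > 0\<close> by (simp flip: u0)
  qed
  have \<Theta>_lim: "(\<Theta> \<longlongrightarrow> \<theta>0) (at_right 0)"
    unfolding \<Theta>_def[abs_def] \<theta>0' using \<open>\<sigma>0 > 0\<close> \<open>u0 > 0\<close> \<open>\<alpha> > 0\<close>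
    by (intro tendsto_intros V_lim S_lim) auto
  have V'_lim: "(V' \<longlongrightarrow> 0) (at_right 0)"
  proof -
    have "(V' \<longlongrightarrow> u0 * - (0 * 1 / n + 0)) (at_right 0)"
      unfolding V'_def[abs_def] using \<open>n > 0\<close> by (intro tendsto_intros V_lim r_0 z_lim q_0) auto
    then show ?thesis by simp
  qed
  have \<Theta>'_lim: "(\<Theta>' \<longlongrightarrow> 0) (at_right 0)"
  proof -
    have "(\<Theta>' \<longlongrightarrow> - ((0 * 1 + (n + 1) * 0) / \<alpha>)) (at_right 0)"
      unfolding \<Theta>'_def[abs_def] using \<open>\<alpha> > 0\<close> by (intro tendsto_intros r_0 z_lim q_0) auto
    then show ?thesis by simp
  qed

  \<comment> \<open>Limits as \<xi> tends to infinity\<close>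
  have z_inf: "(z \<longlongrightarrow> 0) at_top"
    unfolding z_def[abs_def] by (rule filterlim_compose[OF logistic_at_bot T_inf])
  have q_inf: "((\<lambda>\<xi>. Q \<xi>) \<longlongrightarrow> 0) at_top"
  proof -
    have "((\<lambda>\<xi>. Q \<xi>) \<longlongrightarrow> ln (1 - 0)) at_top"
      unfolding Q_def q_def by (intro tendsto_intros z_inf) auto
    then show ?thesis by simp
  qed
  have p_inf: "((\<lambda>\<xi>. P \<xi>) \<longlongrightarrow> 0) at_top"
  proof -
    \<comment> \<open>No limit of \<open>r\<close> is available at this end, but
      \<open>0 < r - n + 1 \<le> n + 1\<close> and \<open>z\<close> tends to 0.\<close>
    have "((\<lambda>\<xi>. (r \<xi> - n + 1) * z \<xi>) \<longlongrightarrow> 0) at_top"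
    proof (rule tendsto_sandwich[OF _ _ tendsto_const])
      show "((\<lambda>\<xi>. (n + 1) * z \<xi>) \<longlongrightarrow> 0) at_top"
        using z_inf by (rule tendsto_mult_right_zero)
      show "\<forall>\<^sub>F \<xi> in at_top. (r \<xi> - n + 1) * z \<xi> \<le> (n + 1) * z \<xi>"
        using r(2) z by (intro always_eventually allI mult_right_mono) (auto simp: less_imp_le)
      show "\<forall>\<^sub>F \<xi> in at_top. 0 \<le> (r \<xi> - n + 1) * z \<xi>"
        using r(4) z by (intro always_eventually allI mult_nonneg_nonneg) (auto intro: less_imp_le)
    qed
    then have "((\<lambda>\<xi>. P \<xi>) \<longlongrightarrow> ln (1 + 0 / \<kappa>)) at_top"
      unfolding P_def p_def using \<kappa> by (intro tendsto_intros) auto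
    then show ?thesis by simp
  qed

  \<comment> \<open>Extension to \<xi> = 0, the system, and the expansions\<close>
  define \<sigma> where "\<sigma> \<xi> = (if \<xi> > 0 then S \<xi> else \<sigma>0)" for \<xi>
  define u where "u \<xi> = (if \<xi> > 0 then V \<xi> else u0)" for \<xi>
  define \<theta> where "\<theta> \<xi> = (if \<xi> > 0 then \<Theta> \<xi> else \<theta>0)" for \<xi>
  define u' where "u' \<xi> = (if \<xi> > 0 then V' \<xi> else 0)" for \<xi>
  define \<theta>' where "\<theta>' \<xi> = (if \<xi> > 0 then \<Theta>' \<xi> else 0)" for \<xi>
  have "\<forall>\<xi>>0. (V has_real_derivative V' \<xi>) (at \<xi>)" using dV by blast
  note u_ext = C1_extension_to_0[OF this cont_V' V_lim V'_lim, folded u_def[abs_def] u'_def[abs_def]]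
  have "\<forall>\<xi>>0. (\<Theta> has_real_derivative \<Theta>' \<xi>) (at \<xi>)" using d\<Theta> by blast
  note \<theta>_ext = C1_extension_to_0[OF this cont_\<Theta>' \<Theta>_lim \<Theta>'_lim, folded \<theta>_def[abs_def] \<theta>'_def[abs_def]]
  have cont_S': "continuous_on {0<..} (\<lambda>\<xi>. \<xi> * V \<xi>)"
    by (intro continuous_intros cont_fun[OF dV])
  have S'_lim: "((\<lambda>\<xi>. \<xi> * V \<xi>) \<longlongrightarrow> 0) (at_right 0)"
    using tendsto_mult[OF tendsto_ident_at V_lim] by simp
  have "\<forall>\<xi>>0. (S has_real_derivative \<xi> * V \<xi>) (at \<xi>)" using dS by blast
  note \<sigma>_ext = C1_extension_to_0[OF this cont_S' S_lim S'_lim, folded \<sigma>_def[abs_def]]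
  have du: "(u has_real_derivative u' \<xi>) (at \<xi> within {0..})"
    and d\<theta>: "(\<theta> has_real_derivative \<theta>' \<xi>) (at \<xi> within {0..})" if "\<xi> \<ge> 0" for \<xi>
    using u_ext(2)[OF that] \<theta>_ext(2)[OF that] by (simp_all add: u'_def \<theta>'_def)
  have d\<sigma>: "(\<sigma> has_real_derivative \<xi> * u \<xi>) (at \<xi> within {0..})" if "\<xi> \<ge> 0" for \<xi>
    using \<sigma>_ext(2)[OF that] that by (cases "\<xi> > 0") (auto simp: u_def)
  \<comment> \<open>The first equation persists at 0, so continuous differentiability of
    \<open>u\<close> yields two continuous derivatives of \<sigma>.\<close>
  have d\<sigma>': "((\<lambda>\<xi>. \<xi> * u \<xi>) has_real_derivative u \<xi> + \<xi> * u' \<xi>) (at \<xi> within {0..})"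
    if "\<xi> \<ge> 0" for \<xi>
    by (rule derivative_eq_intros du that refl)+ simp
  have cont_u: "continuous_on {0..} u"
    using du by (meson DERIV_continuous_on atLeast_iff)
  \<comment> \<open>Since \<open>P\<close> and \<open>Q\<close> vanish at infinity, these forms
    exhibit the leading terms \<open>1 / \<xi>\<close> and \<open>\<xi>\<close>.\<close>
  have V_eq: "V \<xi> = exp ((P \<xi> + Q \<xi>) / 2) / \<xi>" and S_eq: "S \<xi> = \<xi> * exp ((P \<xi> - Q \<xi>) / 2)"
    if "\<xi> > 0" for \<xi>
    using that by (simp_all add: V_def S_def exp_diff exp_add)
  have "profile_solution \<alpha> n \<nu> \<sigma> u \<theta>"
    unfolding profile_solution_def
  proof (intro allI impI conjI exI)
    fix \<xi> :: real assume "\<xi> > 0"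
    show "u \<xi> > 0" using \<open>\<xi> > 0\<close> by (simp add: u_def V_def)
    show "(\<sigma> has_real_derivative \<xi> * u \<xi>) (at \<xi>)"
      using \<sigma>_ext(1)[OF \<open>\<xi> > 0\<close>] \<open>\<xi> > 0\<close> by (simp add: u_def)
    show "(\<theta> has_real_derivative \<Theta>' \<xi>) (at \<xi>)"
      by (rule \<theta>_ext(1)[OF \<open>\<xi> > 0\<close>])
    \<comment> \<open>With \<open>q = 1 - z\<close> the left side collapses to
      \<open>(r - n + 1) * z / \<kappa>\<close>.\<close>
    have "\<nu> * ((n + 1) / \<alpha> + \<xi> * \<Theta>' \<xi>) = p \<xi> - 1"
      using \<open>\<xi> > 0\<close> \<open>\<alpha> > 0\<close> \<open>\<nu> > 0\<close> \<open>n > 0\<close>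
      by (simp add: \<Theta>'_def p_def q_def \<kappa>_def field_simps)
    then show "\<nu> * ((n + 1) / \<alpha> + \<xi> * \<Theta>' \<xi>) = \<sigma> \<xi> * u \<xi> - 1"
      using \<open>\<xi> > 0\<close> SV by (simp add: \<sigma>_def u_def)
    have "exp (- \<alpha> * \<Theta> \<xi>) = exp (ln (S \<xi>) - n * ln (V \<xi>))"
      using \<open>\<alpha> > 0\<close> by (simp add: \<Theta>_def)
    then show "\<sigma> \<xi> = exp (- \<alpha> * \<theta> \<xi>) * u \<xi> powr n"
      using \<open>\<xi> > 0\<close> by (simp add: \<sigma>_def u_def \<theta>_def powr_def exp_diff S_def V_def)
  qed
  moreover have "(\<lambda>\<xi>. u \<xi> - 1 / \<xi>) \<in> o[at_top](\<lambda>\<xi>. 1 / \<xi>)"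
  proof (rule smalloI_tendsto)
    have "((\<lambda>\<xi>. exp ((P \<xi> + Q \<xi>) / 2) - 1) \<longlongrightarrow> exp ((0 + 0) / 2) - 1) at_top"
      by (intro tendsto_intros p_inf q_inf) auto
    moreover have "\<forall>\<^sub>F \<xi> in at_top. exp ((P \<xi> + Q \<xi>) / 2) - 1 = (u \<xi> - 1 / \<xi>) / (1 / \<xi>)"
      using ev_inf by eventually_elim (simp add: u_def V_eq field_simps)
    ultimately show "((\<lambda>\<xi>. (u \<xi> - 1 / \<xi>) / (1 / \<xi>)) \<longlongrightarrow> 0) at_top"
      by (simp add: tendsto_cong)
    show "\<forall>\<^sub>F \<xi> in at_top. 1 / \<xi> \<noteq> (0::real)" using ev_inf by eventually_elim simp
  qed
  moreover have "(\<lambda>\<xi>. \<sigma> \<xi> - \<xi>) \<in> o[at_top](\<lambda>\<xi>. \<xi>)"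
  proof (rule smalloI_tendsto)
    have "((\<lambda>\<xi>. exp ((P \<xi> - Q \<xi>) / 2) - 1) \<longlongrightarrow> exp ((0 - 0) / 2) - 1) at_top"
      by (intro tendsto_intros p_inf q_inf) auto
    moreover have "\<forall>\<^sub>F \<xi> in at_top. exp ((P \<xi> - Q \<xi>) / 2) - 1 = (\<sigma> \<xi> - \<xi>) / \<xi>"
      using ev_inf by eventually_elim (simp add: \<sigma>_def S_eq field_simps)
    ultimately show "((\<lambda>\<xi>. (\<sigma> \<xi> - \<xi>) / \<xi>) \<longlongrightarrow> 0) at_top"
      by (simp add: tendsto_cong)
    show "\<forall>\<^sub>F \<xi> in at_top. \<xi> \<noteq> (0::real)" using ev_inf by eventually_elim simp
  qed
  moreover have "(\<lambda>\<xi>. \<theta> \<xi> - (- ((n + 1) / \<alpha>) * ln \<xi>)) \<in> o[at_top](\<lambda>\<xi>. 1)"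
  proof (rule smalloI_tendsto)
    let ?h = "\<lambda>\<xi>. (n * ((P \<xi> + Q \<xi>) / 2) - (P \<xi> - Q \<xi>) / 2) / \<alpha>"
    have "(?h \<longlongrightarrow> (n * ((0 + 0) / 2) - (0 - 0) / 2) / \<alpha>) at_top"
      using \<open>\<alpha> > 0\<close> by (intro tendsto_intros p_inf q_inf) auto
    moreover have "\<forall>\<^sub>F \<xi> in at_top. ?h \<xi> = (\<theta> \<xi> - (- ((n + 1) / \<alpha>) * ln \<xi>)) / 1"
      using ev_inf
      by eventually_elim (use \<open>\<alpha> > 0\<close> in \<open>simp add: \<theta>_def \<Theta>_def S_def V_def field_simps\<close>)
    ultimately show "((\<lambda>\<xi>. (\<theta> \<xi> - (- ((n + 1) / \<alpha>) * ln \<xi>)) / 1) \<longlongrightarrow> 0) at_top"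
      by (simp add: tendsto_cong)
  qed simp
  moreover have "Ck_on 1 u {0..}"
    unfolding One_nat_def by (rule Ck_on_SucI) (use du u_ext(3) in auto)
  moreover have "Ck_on 1 \<theta> {0..}"
    unfolding One_nat_def by (rule Ck_on_SucI) (use d\<theta> \<theta>_ext(3) in auto)
  moreover have "Ck_on 2 \<sigma> {0..}"
    unfolding numeral_2_eq_2
  proof (rule Ck_on_SucI)
    show "Ck_on (Suc 0) (\<lambda>\<xi>. \<xi> * u \<xi>) {0..}"
    proof (rule Ck_on_SucI)
      show "Ck_on 0 (\<lambda>\<xi>. u \<xi> + \<xi> * u' \<xi>) {0..}"
        unfolding Ck_on.simps by (intro continuous_intros cont_u u_ext(3))
    qed (use d\<sigma>' in simp)
  qed (use d\<sigma> in simp)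
  moreover have d0: "(\<sigma> has_real_derivative 0) (at 0 within {0..})"
    "(u has_real_derivative 0) (at 0 within {0..})" "(\<theta> has_real_derivative 0) (at 0 within {0..})"
    using d\<sigma>[of 0] du[of 0] d\<theta>[of 0] by (simp_all add: u'_def \<theta>'_def)
  moreover have ini: "\<sigma> 0 = \<sigma>0" "u 0 = u0" "\<theta> 0 = \<theta>0"
    by (simp_all add: \<sigma>_def u_def \<theta>_def)
  moreover have "(\<lambda>\<xi>. u \<xi> - u0) \<in> o[at_right 0](\<lambda>\<xi>. \<xi>)"
    "(\<lambda>\<xi>. \<theta> \<xi> - \<theta>0) \<in> o[at_right 0](\<lambda>\<xi>. \<xi>)"
    using d0(2,3) ini ev0
    by (auto intro!: smalloI_tendsto simp: has_field_derivative_iff at_within_Ici_at_right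
      elim!: eventually_mono)
  moreover have "(\<lambda>\<xi>. \<sigma> \<xi> - (\<sigma>0 + 1 / 2 * u0 * \<xi>\<^sup>2)) \<in> o[at_right 0](\<lambda>\<xi>. \<xi>\<^sup>2)"
  proof (rule smalloI_tendsto)
    show "((\<lambda>\<xi>. (\<sigma> \<xi> - (\<sigma>0 + 1 / 2 * u0 * \<xi>\<^sup>2)) / \<xi>\<^sup>2) \<longlongrightarrow> 0) (at_right 0)"
    \<comment> \<open>The quotient of derivatives is \<open>(V \<xi> - u0) / 2\<close>, so the
      second-order expansion follows from the limit of \<open>V\<close> alone.\<close>
    proof (rule lhopital_right_0)
      have "((\<lambda>\<xi>. \<sigma> \<xi> - (\<sigma>0 + 1 / 2 * u0 * \<xi>\<^sup>2)) \<longlongrightarrow> \<sigma>0 - (\<sigma>0 + 1 / 2 * u0 * 0\<^sup>2)) (at_right 0)"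
        by (intro tendsto_intros \<sigma>_ext(4))
      then show "((\<lambda>\<xi>. \<sigma> \<xi> - (\<sigma>0 + 1 / 2 * u0 * \<xi>\<^sup>2)) \<longlongrightarrow> 0) (at_right 0)" by simp
      have "((\<lambda>\<xi>. \<xi>\<^sup>2) \<longlongrightarrow> 0\<^sup>2) (at_right (0::real))" by (intro tendsto_intros)
      then show "((\<lambda>\<xi>. \<xi>\<^sup>2) \<longlongrightarrow> 0) (at_right (0::real))" by simp
      show "\<forall>\<^sub>F \<xi> in at_right 0. ((\<lambda>\<xi>. \<sigma> \<xi> - (\<sigma>0 + 1 / 2 * u0 * \<xi>\<^sup>2)) has_real_derivative
          \<xi> * V \<xi> - u0 * \<xi>) (at \<xi>)"
        using ev0 by eventually_elim (auto intro!: derivative_eq_intros \<sigma>_ext(1))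
      show "\<forall>\<^sub>F \<xi> in at_right (0::real). ((\<lambda>\<xi>. \<xi>\<^sup>2) has_real_derivative 2 * \<xi>) (at \<xi>)"
        by (auto intro!: always_eventually derivative_eq_intros)
      have "((\<lambda>\<xi>. (V \<xi> - u0) / 2) \<longlongrightarrow> (u0 - u0) / 2) (at_right 0)"
        by (intro tendsto_intros V_lim) auto
      moreover have "\<forall>\<^sub>F \<xi> in at_right 0. (V \<xi> - u0) / 2 = (\<xi> * V \<xi> - u0 * \<xi>) / (2 * \<xi>)"
        using ev0 by eventually_elim (simp add: field_simps)
      ultimately show "((\<lambda>\<xi>. (\<xi> * V \<xi> - u0 * \<xi>) / (2 * \<xi>)) \<longlongrightarrow> 0) (at_right 0)"
        using Lim_transform_eventually by fastforce
    qed (use ev0 in \<open>auto elim!: eventually_mono\<close>)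
  qed (use ev0 in \<open>auto elim!: eventually_mono\<close>)
  ultimately show "\<exists>\<sigma> u \<theta> :: real \<Rightarrow> real.
      profile_solution \<alpha> n \<nu> \<sigma> u \<theta> \<and>
      \<sigma> 0 = \<sigma>0 \<and> u 0 = u0 \<and> \<theta> 0 = \<theta>0 \<and>
      (\<sigma> \<longlongrightarrow> \<sigma>0) (at_right 0) \<and>
      (u \<longlongrightarrow> u0) (at_right 0) \<and>
      (\<theta> \<longlongrightarrow> \<theta>0) (at_right 0) \<and>
      (\<lambda>\<xi>. u \<xi> - 1 / \<xi>) \<in> o[at_top](\<lambda>\<xi>. 1 / \<xi>) \<and>
      (\<lambda>\<xi>. \<sigma> \<xi> - \<xi>) \<in> o[at_top](\<lambda>\<xi>. \<xi>) \<and>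
      (\<lambda>\<xi>. \<theta> \<xi> - (- ((n + 1) / \<alpha>) * ln \<xi>)) \<in> o[at_top](\<lambda>\<xi>. 1) \<and>
      Ck_on 1 u {0..} \<and> Ck_on 1 \<theta> {0..} \<and> Ck_on 2 \<sigma> {0..} \<and>
      (\<sigma> has_real_derivative 0) (at 0 within {0..}) \<and>
      (u has_real_derivative 0) (at 0 within {0..}) \<and>
      (\<theta> has_real_derivative 0) (at 0 within {0..}) \<and>
      (\<lambda>\<xi>. u \<xi> - u0) \<in> o[at_right 0](\<lambda>\<xi>. \<xi>) \<and>
      (\<lambda>\<xi>. \<sigma> \<xi> - (\<sigma>0 + 1 / 2 * u0 * \<xi>\<^sup>2)) \<in> o[at_right 0](\<lambda>\<xi>. \<xi>\<^sup>2) \<and>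
      (\<lambda>\<xi>. \<theta> \<xi> - \<theta>0) \<in> o[at_right 0](\<lambda>\<xi>. \<xi>)"
    using \<sigma>_ext(4) u_ext(4) \<theta>_ext(4) by (intro exI[of _ \<sigma>] exI[of _ u] exI[of _ \<theta>] conjI)
qed

end
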